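(* (Perron's formula.) Let $T_1,\dots,T_r$ be new indeterminates. Let $\widetilde{F}:A[T_1,\dots,T_r]\to A[\widetilde{\underline{X}}_1,\dots,\widetilde{\underline{X}}_s]$ be the homomorphism of $A$-algebras with $\widetilde{F}(T_i)=\widetilde{f}_i$ for $1\le i\le r$, and let $G$ be the automorphism of the $A'[T_1,\dots,T_r]$-algebra $A[T_1,\dots,T_r]$ with $G(\varepsilon_i)=\varepsilon_i-T_i$ for $1\le i\le r$. Then $$\ker\widetilde{F}=G(\mathfrak{A}[T_1,\dots,T_r]).$$
   Context: Let $K$ be a commutative integral domain, $s\ge 1$, and $n_s\ge\dots\ge n_1\ge 1$ integers. For $1\le j\le s$ let $\underline{X}_j=(X_{j,1},\dots,X_{j,n_j+1})$ be a packet of indeterminates; for $\underline{\alpha}_j\in\mathbb{N}^{n_j+1}$ let $|\underline{\alpha}_j|$ be the sum of its entries and $\underline{X}_j^{\underline{\alpha}_j}$ the corresponding monomial. Let $r\in\mathbb{N}$ and $d_{i,j}\ge 1$ ($1\le i\le r$, $1\le j\le s$) be integers. Let $A=K[U_{i,\underline{\alpha}_1,\dots,\underline{\alpha}_s}]$ be the polynomial ring in indeterminates indexed by $1\le i\le r$ and $\underline{\alpha}_j\in\mathbb{N}^{n_j+1}$ with $|\underline{\alpha}_j|=d_{i,j}$ for all $j$. Let $C=A[\underline{X}_1,\dots,\underline{X}_s]$, $f_i=\sum U_{i,\underline{\alpha}_1,\dots,\underline{\alpha}_s}\underline{X}_1^{\underline{\alpha}_1}\cdots\underline{X}_s^{\underline{\alpha}_s}\in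 C$ (sum over all $(\underline{\alpha}_j)_j$ with $|\underline{\alpha}_j|=d_{i,j}$), and $B=C/(f_1,\dots,f_r)$. For $1\le i_j\le n_j+1$ put $\sigma_{i_1\dots i_s}=X_{1,i_1}\cdots X_{s,i_s}$. Let $p:C\to B$ be the canonical surjection and $\pi:B\to\prod_{i_1,\dots,i_s}B_{\sigma_{i_1\dots i_s}}$, $b\mapsto(b/1,\dots,b/1)$. The ideal of forms of inertia is $\mathcal{T}=p^{-1}(\ker\pi)\subset C$, and the resultant ideal is $\mathfrak{A}=\mathcal{T}\cap A$. Let $\varepsilon_i$ be the coefficient (one of the indeterminates $U$) of $X_{1,n_1+1}^{d_{i,1}}\cdots X_{s,n_s+1}^{d_{i,s}}$ in $f_i$. Let $A'$ be the polynomial ring over $K$ in all the indeterminates $U_{i,\underline{\alpha}_1,\dots,\underline{\alpha}_s}$ other than $\varepsilon_1,\dots,\varepsilon_r$, so $A=A'[\varepsilon_1,\dots,\varepsilon_r]$. Put $\widetilde{\underline{X}}_j=(X_{j,1},\dots,X_{j,n_j},1)$ and $\widetilde{f}_i=f_i(\widetilde{\underline{X}}_1,\dots,\widetilde{\underline{X}}_s)$; $A[\widetilde{\underline{X}}_1,\dots,\widetilde{\underline{X}}_s]$ is the polynomial ring over $A$ in the $X_{j,l}$ with $1\le l\le n_j$, $1\le j\le s$. $\mathfrak{A}[T_1,\dots,T_r]$ denotes the set of polynomials in the $T_i$ with coefficients in $\mathfrak{A}$. *)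

theory Defs
  imports "HOL-Library.Poly_Mapping" "HOL-Algebra.QuotRing"
begin

section \<open>Polynomials in an arbitrary set of indeterminates\<close>

type_synonym ('v, 'a) mpol = "('v \<Rightarrow>\<^sub>0 nat) \<Rightarrow>\<^sub>0 'a"

definition mconst :: "'a::comm_ring_1 \<Rightarrow> ('v, 'a) mpol" where
  "mconst a = Poly_Mapping.single 0 a"

definition mvar :: "'v \<Rightarrow> ('v, 'a::comm_ring_1) mpol" where
  "mvar v = Poly_Mapping.single (Poly_Mapping.single v 1) 1"

text \<open>\<open>poly_set V S\<close> is the set \<open>S[V]\<close> of polynomials in the indeterminates \<open>V\<close> with
  coefficients in \<open>S\<close>; here \<open>S\<close> may be a subring, but also an ideal of a subring.\<close>

definition poly_set :: "'v set \<Rightarrow> 'a::comm_ring_1 set \<Rightarrow> ('v, 'a) mpol set" where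
  "poly_set V S = {p. \<forall>m\<in>Poly_Mapping.keys p. Poly_Mapping.keys m \<subseteq> V \<and> Poly_Mapping.lookup p m \<in> S}"

definition meval :: "('a \<Rightarrow> 'b) \<Rightarrow> ('v \<Rightarrow> 'b) \<Rightarrow> ('v, 'a::comm_ring_1) mpol \<Rightarrow> 'b::comm_ring_1" where
  "meval \<phi> x p = (\<Sum>m\<in>Poly_Mapping.keys p. \<phi> (Poly_Mapping.lookup p m) * (\<Prod>v\<in>Poly_Mapping.keys m. x v ^ Poly_Mapping.lookup m v))"

definition subring_of :: "'a::comm_ring_1 set \<Rightarrow> 'a ring" where
  "subring_of S = \<lparr>carrier = S, mult = (*), one = 1, zero = 0, add = (+)\<rparr>"


section \<open>Localizations and products of commutative rings\<close>

definition frac_rel :: "('a, 'm) ring_scheme \<Rightarrow> 'a set \<Rightarrow> (('a \<times> 'a) \<times> ('a \<times> 'a)) set" where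
  "frac_rel R S = {((a, s), (b, t)). a \<in> carrier R \<and> s \<in> S \<and> b \<in> carrier R \<and> t \<in> S \<and>
     (\<exists>u\<in>S. u \<otimes>\<^bsub>R\<^esub> (a \<otimes>\<^bsub>R\<^esub> t) = u \<otimes>\<^bsub>R\<^esub> (b \<otimes>\<^bsub>R\<^esub> s))}"

definition mk_frac :: "('a, 'm) ring_scheme \<Rightarrow> 'a set \<Rightarrow> 'a \<Rightarrow> 'a \<Rightarrow> ('a \<times> 'a) set" where
  "mk_frac R S a s = frac_rel R S `` {(a, s)}"

text \<open>The unions range over all representatives; since the operations respect
  \<^const>\<open>frac_rel\<close> for multiplicative \<open>S\<close>, all members of a union coincide.\<close>

definition localization :: "('a, 'm) ring_scheme \<Rightarrow> 'a set \<Rightarrow> ('a \<times> 'a) set ring" where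
  "localization R S =
    \<lparr>carrier = (carrier R \<times> S) // frac_rel R S,
     mult = (\<lambda>x y. \<Union>(a, s)\<in>x. \<Union>(b, t)\<in>y. mk_frac R S (a \<otimes>\<^bsub>R\<^esub> b) (s \<otimes>\<^bsub>R\<^esub> t)),
     one = mk_frac R S \<one>\<^bsub>R\<^esub> \<one>\<^bsub>R\<^esub>,
     zero = mk_frac R S \<zero>\<^bsub>R\<^esub> \<one>\<^bsub>R\<^esub>,
     add = (\<lambda>x y. \<Union>(a, s)\<in>x. \<Union>(b, t)\<in>y.
              mk_frac R S ((a \<otimes>\<^bsub>R\<^esub> t) \<oplus>\<^bsub>R\<^esub> (b \<otimes>\<^bsub>R\<^esub> s)) (s \<otimes>\<^bsub>R\<^esub> t))\<rparr>"

definition powers_of :: "('a, 'm) ring_scheme \<Rightarrow> 'a \<Rightarrow> 'a set" where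
  "powers_of R x = {x [^]\<^bsub>R\<^esub> k | k :: nat. True}"

definition product_ring :: "'i set \<Rightarrow> ('i \<Rightarrow> 'a ring) \<Rightarrow> ('i \<Rightarrow> 'a) ring" where
  "product_ring I R =
    \<lparr>carrier = (\<Pi>\<^sub>E i\<in>I. carrier (R i)),
     mult = (\<lambda>x y. \<lambda>i\<in>I. x i \<otimes>\<^bsub>R i\<^esub> y i),
     one = (\<lambda>i\<in>I. \<one>\<^bsub>R i\<^esub>),
     zero = (\<lambda>i\<in>I. \<zero>\<^bsub>R i\<^esub>),
     add = (\<lambda>x y. \<lambda>i\<in>I. x i \<oplus>\<^bsub>R i\<^esub> y i)\<rparr>"


section \<open>Generic multihomogeneous forms and their resultant ideal\<close>

text \<open>The pair \<open>(j, l)\<close> indexes $X_{j,l}$.  A tuple of exponent vectors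
  $(\underline\alpha_1,\dots,\underline\alpha_s)$ is encoded as the single monomial
  $\underline X_1^{\underline\alpha_1}\cdots\underline X_s^{\underline\alpha_s}$, and
  \<open>(i, m)\<close> indexes the coefficient $U_{i,m}$ of the monomial \<open>m\<close> in $f_i$.\<close>

type_synonym xvar = "nat \<times> nat"
type_synonym uvar = "nat \<times> (xvar \<Rightarrow>\<^sub>0 nat)"
type_synonym 'k coef = "(uvar, 'k) mpol"

context
  fixes r s :: nat and n :: "nat \<Rightarrow> nat" and d :: "nat \<Rightarrow> nat \<Rightarrow> nat"
begin

definition X_vars :: "xvar set" where
  "X_vars = {(j, l). j \<in> {1..s} \<and> l \<in> {1..n j + 1}}"

definition Xt_vars :: "xvar set" where
  "Xt_vars = {(j, l). j \<in> {1..s} \<and> l \<in> {1..n j}}"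

definition form_monos :: "nat \<Rightarrow> (xvar \<Rightarrow>\<^sub>0 nat) set" where
  "form_monos i = {m. Poly_Mapping.keys m \<subseteq> X_vars \<and> (\<forall>j\<in>{1..s}. (\<Sum>l\<in>{1..n j + 1}. Poly_Mapping.lookup m (j, l)) = d i j)}"

definition U_vars :: "uvar set" where
  "U_vars = {(i, m). i \<in> {1..r} \<and> m \<in> form_monos i}"

definition eps_var :: "nat \<Rightarrow> uvar" where
  "eps_var i = (i, \<Sum>j\<in>{1..s}. Poly_Mapping.single (j, n j + 1) (d i j))"

definition A_set :: "'k::idom coef set" where
  "A_set = poly_set U_vars UNIV"

definition A'_set :: "'k::idom coef set" where
  "A'_set = poly_set (U_vars - eps_var ` {1..r}) UNIV"

definition C_set :: "(xvar, 'k::idom coef) mpol set" where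
  "C_set = poly_set X_vars A_set"

definition Xt_set :: "(xvar, 'k::idom coef) mpol set" where
  "Xt_set = poly_set Xt_vars A_set"

definition gen_form :: "nat \<Rightarrow> (xvar, 'k::idom coef) mpol" where
  "gen_form i = (\<Sum>m\<in>form_monos i. Poly_Mapping.single m (mvar (i, m)))"

definition gen_form_dehom :: "nat \<Rightarrow> (xvar, 'k::idom coef) mpol" where
  "gen_form_dehom i = meval mconst (\<lambda>(j, l). if l = n j + 1 then 1 else mvar (j, l)) (gen_form i)"

definition form_ideal :: "(xvar, 'k::idom coef) mpol set" where
  "form_ideal = Idl\<^bsub>subring_of C_set\<^esub> (gen_form ` {1..r})"

definition B_ring :: "(xvar, 'k::idom coef) mpol set ring" where
  "B_ring = subring_of C_set Quot form_ideal"

definition p_map :: "(xvar, 'k::idom coef) mpol \<Rightarrow> (xvar, 'k coef) mpol set" where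
  "p_map c = form_ideal +>\<^bsub>subring_of C_set\<^esub> c"

definition sigma_indices :: "(nat \<Rightarrow> nat) set" where
  "sigma_indices = (\<Pi>\<^sub>E j\<in>{1..s}. {1..n j + 1})"

definition sigma :: "(nat \<Rightarrow> nat) \<Rightarrow> (xvar, 'k::idom coef) mpol" where
  "sigma \<iota> = (\<Prod>j\<in>{1..s}. mvar (j, \<iota> j))"

definition sigma_powers :: "(nat \<Rightarrow> nat) \<Rightarrow> (xvar, 'k::idom coef) mpol set set" where
  "sigma_powers \<iota> = powers_of B_ring (p_map (sigma \<iota>))"

definition loc_product ::
    "((nat \<Rightarrow> nat) \<Rightarrow> ((xvar, 'k::idom coef) mpol set \<times> (xvar, 'k coef) mpol set) set) ring" where
  "loc_product = product_ring sigma_indices (\<lambda>\<iota>. localization B_ring (sigma_powers \<iota>))"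

definition pi_map :: "(xvar, 'k::idom coef) mpol set \<Rightarrow>
    (nat \<Rightarrow> nat) \<Rightarrow> ((xvar, 'k coef) mpol set \<times> (xvar, 'k coef) mpol set) set" where
  "pi_map b = (\<lambda>\<iota>\<in>sigma_indices. mk_frac B_ring (sigma_powers \<iota>) b \<one>\<^bsub>B_ring\<^esub>)"

definition inertia_forms :: "(xvar, 'k::idom coef) mpol set" where
  "inertia_forms = {c \<in> C_set. p_map c \<in> a_kernel B_ring loc_product pi_map}"

definition resultant_ideal :: "'k::idom coef set" where
  "resultant_ideal = {a \<in> A_set. mconst a \<in> inertia_forms}"

definition AT_set :: "(nat, 'k::idom coef) mpol set" where
  "AT_set = poly_set {1..r} A_set"

definition A'T_set :: "(nat, 'k::idom coef) mpol set" where
  "A'T_set = poly_set {1..r} A'_set"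

end


section \<open>Existence of the homomorphisms in Perron's formula\<close>

text \<open>The $A$-algebra homomorphism $A[T] \to A[\widetilde X]$ with $T_i \mapsto \widetilde f_i$ and the
  automorphism of $A[T]$ over $A'[T]$ with $\varepsilon_i \mapsto \varepsilon_i - T_i$ are
  determined by these properties; \<open>F_exists\<close> and \<open>G_exists\<close> below show that they exist, for
  all values of the parameters.\<close>

definition comm_ring_hom_ty :: "('a::comm_ring_1 \<Rightarrow> 'b::comm_ring_1) \<Rightarrow> bool" where
  "comm_ring_hom_ty h \<longleftrightarrow> h 1 = 1 \<and> (\<forall>x y. h (x + y) = h x + h y \<and> h (x * y) = h x * h y)"

definition is_subring :: "'a::comm_ring_1 set \<Rightarrow> bool" where
  "is_subring S \<longleftrightarrow> 1 \<in> S \<and> (\<forall>x\<in>S. \<forall>y\<in>S. x + y \<in> S \<and> x * y \<in> S \<and> - x \<in> S)"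

lemma homD:
  assumes "comm_ring_hom_ty h"
  shows "h 0 = 0" "h 1 = 1" "h (x + y) = h x + h y" "h (x * y) = h x * h y" "h (- x) = - h x"
    "h (x - y) = h x - h y" "h (x ^ k) = h x ^ k" "h (sum f I) = (\<Sum>i\<in>I. h (f i))" "h (prod f I) = (\<Prod>i\<in>I. h (f i))"
proof -
  have a: "h (x + y) = h x + h y" and m: "h (x * y) = h x * h y" and o: "h 1 = 1" for x y
    using assms by (auto simp: comm_ring_hom_ty_def)
  show z: "h 0 = 0" using a[of 0 0] by simp
  have u: "h (- x) = - h x" for x using a[of x "- x"] z by (simp add: eq_neg_iff_add_eq_0 add.commute)
  show "h (- x) = - h x" by (rule u)
  show "h (x - y) = h x - h y" using a[of x "- y"] u by simp
  show "h (x + y) = h x + h y" "h (x * y) = h x * h y" "h 1 = 1" by (fact a m o)+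
  show "h (x ^ k) = h x ^ k" by (induction k) (auto simp: m o)
  show "h (sum f I) = (\<Sum>i\<in>I. h (f i))" by (induction I rule: infinite_finite_induct) (auto simp: a z)
  show "h (prod f I) = (\<Prod>i\<in>I. h (f i))" by (induction I rule: infinite_finite_induct) (auto simp: m o)
qed

lemma subringD:
  assumes "is_subring S"
  shows "0 \<in> S" "1 \<in> S" "x \<in> S \<Longrightarrow> y \<in> S \<Longrightarrow> x + y \<in> S" "x \<in> S \<Longrightarrow> y \<in> S \<Longrightarrow> x * y \<in> S"
    "x \<in> S \<Longrightarrow> - x \<in> S"  "x \<in> S \<Longrightarrow> y \<in> S \<Longrightarrow> x - y \<in> S" "x \<in> S \<Longrightarrow> x ^ k \<in> S"
    "(\<And>i. i \<in> I \<Longrightarrow> f i \<in> S) \<Longrightarrow> sum f I \<in> S" "(\<And>i. i \<in> I \<Longrightarrow> f i \<in> S) \<Longrightarrow> prod f I \<in> S"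
proof -
  have a: "x \<in> S \<Longrightarrow> y \<in> S \<Longrightarrow> x + y \<in> S" and m: "x \<in> S \<Longrightarrow> y \<in> S \<Longrightarrow> x * y \<in> S" 
    and u: "x \<in> S \<Longrightarrow> - x \<in> S" and o: "1 \<in> S" for x y
    using assms by (auto simp: is_subring_def)
  show z: "0 \<in> S" using a[OF o u[OF o]] by simp
  show "x \<in> S \<Longrightarrow> y \<in> S \<Longrightarrow> x - y \<in> S" using a[of x "- y"] u by simp
  show "x \<in> S \<Longrightarrow> y \<in> S \<Longrightarrow> x + y \<in> S" "x \<in> S \<Longrightarrow> y \<in> S \<Longrightarrow> x * y \<in> S" "1 \<in> S" "x \<in> S \<Longrightarrow> - x \<in> S" using a m o u by auto
  show "x \<in> S \<Longrightarrow> x ^ k \<in> S" by (induction k) (auto simp: m o)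
  show "(\<And>i. i \<in> I \<Longrightarrow> f i \<in> S) \<Longrightarrow> sum f I \<in> S" by (induction I rule: infinite_finite_induct) (auto simp: a z)
  show "(\<And>i. i \<in> I \<Longrightarrow> f i \<in> S) \<Longrightarrow> prod f I \<in> S" by (induction I rule: infinite_finite_induct) (auto simp: m o)
qed

lemma keys_mon_add: "Poly_Mapping.keys (a + b :: 'v \<Rightarrow>\<^sub>0 nat) = Poly_Mapping.keys a \<union> Poly_Mapping.keys b"
  by (auto simp: in_keys_iff lookup_add)

lemma poly_set_subring:
  assumes S: "is_subring S"
  shows "is_subring (poly_set V S)"
  unfolding is_subring_def
proof (intro conjI ballI)
  note [simp] = subringD[OF S]
  have mem: "p \<in> poly_set V S \<longleftrightarrow> (\<forall>m. Poly_Mapping.lookup p m \<in> S) \<and> (\<forall>m\<in>Poly_Mapping.keys p. Poly_Mapping.keys m \<subseteq> V)" for p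
    unfolding poly_set_def using subringD(1)[OF S] by (auto simp: in_keys_iff)
  show "1 \<in> poly_set V S" by (auto simp: poly_set_def)
  fix x y assume xy: "x \<in> poly_set V S" "y \<in> poly_set V S"
  show "x + y \<in> poly_set V S" using xy keys_add[of x y] unfolding mem lookup_add by (metis UnE subringD(3)[OF S] subsetD)
  show "- x \<in> poly_set V S" using xy by (auto simp: mem)
  have "Poly_Mapping.lookup (x * y) m \<in> S" for m
  proof -
    have "Poly_Mapping.lookup (x * y) m \<in> S"
      unfolding lookup_mult Sum_any.expand_set
      using xy by (auto simp: mem when_def intro!: subringD(8)[OF S] subringD(4)[OF S])
    then show ?thesis .
  qed
  moreover have "Poly_Mapping.keys m \<subseteq> V" if mk: "m \<in> Poly_Mapping.keys (x * y)" for m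
    proof -
    obtain a b where "m = a + b" "a \<in> Poly_Mapping.keys x" "b \<in> Poly_Mapping.keys y"
      using keys_mult[of x y] mk by blast
    then show ?thesis using xy by (simp add: mem keys_mon_add)
  qed
  ultimately show "x * y \<in> poly_set V S" by (auto simp: mem)
qed

lemma is_subring_UNIV: "is_subring UNIV" by (auto simp: is_subring_def)

lemma mconst_mem: "is_subring S \<Longrightarrow> a \<in> S \<Longrightarrow> mconst a \<in> poly_set V S"
  by (auto simp: mconst_def poly_set_def split: if_splits)

lemma mvar_mem: "is_subring S \<Longrightarrow> v \<in> V \<Longrightarrow> mvar v \<in> poly_set V S"
  by (auto simp: mvar_def poly_set_def subringD split: if_splits)

lemma mconst_hom: "comm_ring_hom_ty mconst"
  by (auto simp: comm_ring_hom_ty_def mconst_def single_add mult_single)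

definition meval_mon :: "('v \<Rightarrow> 'b) \<Rightarrow> ('v \<Rightarrow>\<^sub>0 nat) \<Rightarrow> 'b::comm_ring_1" where
  "meval_mon x m = (\<Prod>v\<in>Poly_Mapping.keys m. x v ^ Poly_Mapping.lookup m v)"

lemma meval_mon_superset:
  assumes "finite W" "Poly_Mapping.keys m \<subseteq> W"
  shows "meval_mon x m = (\<Prod>v\<in>W. x v ^ Poly_Mapping.lookup m v)"
  unfolding meval_mon_def by (rule prod.mono_neutral_left) (use assms in \<open>auto simp: in_keys_iff\<close>)

lemma meval_mon_add: "meval_mon x (a + b) = meval_mon x a * meval_mon x b"
proof -
  let ?W = "Poly_Mapping.keys a \<union> Poly_Mapping.keys b"
  have "meval_mon x (a + b) = (\<Prod>v\<in>?W. x v ^ Poly_Mapping.lookup (a + b) v)"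
    by (rule meval_mon_superset) (auto simp: keys_mon_add)
  also have "\<dots> = meval_mon x a * meval_mon x b"
    by (simp add: meval_mon_superset[of ?W a] meval_mon_superset[of ?W b] lookup_add power_add prod.distrib)
  finally show ?thesis .
qed

lemma meval_alt: "meval \<phi> x p = (\<Sum>m\<in>Poly_Mapping.keys p. \<phi> (Poly_Mapping.lookup p m) * meval_mon x m)"
  by (simp add: meval_def meval_mon_def)

lemma mpol_expand: "(p :: 'v \<Rightarrow>\<^sub>0 'c::comm_monoid_add) = (\<Sum>m\<in>Poly_Mapping.keys p. Poly_Mapping.single m (Poly_Mapping.lookup p m))"
  by (rule poly_mapping_eqI) (auto simp: lookup_sum lookup_single when_def in_keys_iff)

lemma mpol_induct:
  fixes p :: "'v \<Rightarrow>\<^sub>0 'c::comm_monoid_add"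
  assumes "P 0" "\<And>m a. P (Poly_Mapping.single m a)" "\<And>p q. P p \<Longrightarrow> P q \<Longrightarrow> P (p + q)"
  shows "P p"
proof -
  have "P (\<Sum>m\<in>I. Poly_Mapping.single m (Poly_Mapping.lookup p m))" for I
    by (induction I rule: infinite_finite_induct) (auto intro: assms)
  from this[of "Poly_Mapping.keys p"] show ?thesis using mpol_expand[of p] by simp
qed

context
  fixes \<phi> :: "'a::comm_ring_1 \<Rightarrow> 'b::comm_ring_1"
  assumes hom: "comm_ring_hom_ty \<phi>"
begin

lemma meval_add: "meval \<phi> x (p + q) = meval \<phi> x p + meval \<phi> x q"
  unfolding meval_alt
  by (rule setsum_keys_plus_distrib) (auto simp: homD[OF hom] distrib_right)

lemma meval_single: "meval \<phi> x (Poly_Mapping.single m a) = \<phi> a * meval_mon x m"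
  by (auto simp: meval_alt homD[OF hom])

lemma meval_0: "meval \<phi> x 0 = 0" by (simp add: meval_alt)

lemma meval_mult: "meval \<phi> x (p * q) = meval \<phi> x p * meval \<phi> x q"
proof (induction p rule: mpol_induct)
  case (2 m a)
  show ?case
  proof (induction q rule: mpol_induct)
    case (2 m' b)
    show ?case by (simp add: meval_single mult_single homD[OF hom] meval_mon_add mult_ac)
  qed (simp_all add: meval_0 distrib_left meval_add)
qed (auto simp: meval_0 distrib_right meval_add)

lemma meval_hom: "comm_ring_hom_ty (meval \<phi> x)"
  using meval_single[of x 0 1]
  by (auto simp: comm_ring_hom_ty_def meval_add meval_mult homD[OF hom] meval_mon_def single_one[symmetric] simp del: single_one)

lemma meval_mconst: "meval \<phi> x (mconst a) = \<phi> a"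
  by (simp add: mconst_def meval_single meval_mon_def)

lemma meval_mvar: "meval \<phi> x (mvar v) = x v"
  by (simp add: mvar_def meval_single meval_mon_def homD[OF hom])

lemma meval_mem:
  assumes "is_subring S" "\<And>a. a \<in> R \<Longrightarrow> \<phi> a \<in> S" "\<And>v. v \<in> V \<Longrightarrow> x v \<in> S" "p \<in> poly_set V R"
  shows "meval \<phi> x p \<in> S"
  unfolding meval_def
  using assms(2-4) by (auto intro!: subringD[OF assms(1)] simp: poly_set_def)

end

lemma single_eq: "Poly_Mapping.single m a = mconst a * (\<Prod>v\<in>Poly_Mapping.keys m. mvar v ^ Poly_Mapping.lookup m v)"
proof -
  have p: "mvar v ^ k = Poly_Mapping.single (Poly_Mapping.single v k) (1::'b)" for v k
    by (induction k) (auto simp: mvar_def mult_single single_add[symmetric])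
  have s: "(\<Prod>v\<in>I. Poly_Mapping.single (f v) (1::'b)) = Poly_Mapping.single (\<Sum>v\<in>I. f v) 1" if "finite I" for I f
    using that by (induction I) (auto simp: mult_single)
  show ?thesis
    using mpol_expand[of m] by (simp add: p s mconst_def mult_single)
qed

lemma hom_eqI:
  assumes "comm_ring_hom_ty h" "comm_ring_hom_ty g" "\<And>a. h (mconst a) = g (mconst a)" "\<And>v. h (mvar v) = g (mvar v)"
  shows "h p = g p"
  by (induction p rule: mpol_induct)
     (simp_all add: single_eq homD[OF assms(1)] homD[OF assms(2)] assms(3,4))

lemma comp_hom: "comm_ring_hom_ty h \<Longrightarrow> comm_ring_hom_ty g \<Longrightarrow> comm_ring_hom_ty (\<lambda>x. h (g x))"
  by (auto simp: comm_ring_hom_ty_def)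

lemma ring_homI: "comm_ring_hom_ty h \<Longrightarrow> (\<And>x. x \<in> S \<Longrightarrow> h x \<in> T) \<Longrightarrow> h \<in> ring_hom (subring_of S) (subring_of T)"
  by (auto simp: ring_hom_def comm_ring_hom_ty_def subring_of_def)

lemma A_subring: "is_subring (A_set r s n d)" 
  unfolding A_set_def by (intro poly_set_subring is_subring_UNIV)

lemma finite_X: "finite (X_vars s n)"
proof -
  have "X_vars s n = (SIGMA j:{1..s}. {1..n j + 1})" by (auto simp: X_vars_def)
  then show ?thesis by simp
qed

lemma eps_mono: "snd (eps_var s n d i) \<in> form_monos s n d i"
proof -
  have L: "Poly_Mapping.lookup (snd (eps_var s n d i)) (j, l) = (if j \<in> {1..s} \<and> l = n j + 1 then d i j else 0)" for j l
  proof -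
    have "Poly_Mapping.lookup (snd (eps_var s n d i)) (j, l) = (\<Sum>x\<in>{1..s}. if x = j then (if l = n j + 1 then d i j else 0) else 0)"
      unfolding eps_var_def snd_conv lookup_sum by (rule sum.cong) (auto simp: lookup_single when_def)
    then show ?thesis by simp
  qed
  show ?thesis unfolding form_monos_def
    by (auto simp: in_keys_iff L X_vars_def split: if_splits prod.splits)
qed

lemma eps_mem: "i \<in> {1..r} \<Longrightarrow> eps_var s n d i \<in> U_vars r s n d"
  using eps_mono[of s n d i] by (auto simp: U_vars_def eps_var_def)

lemma form_monos_finite:
  shows "finite (form_monos s n d i)"
proof -
  define N where "N = (\<Sum>j\<in>{1..s}. d i j)"
  have "inj_on Poly_Mapping.lookup (form_monos s n d i)" by (auto intro: inj_onI)
  moreover have "Poly_Mapping.lookup ` form_monos s n d i \<subseteq> {f. (\<forall>x\<in>X_vars s n. f x \<in> {..N}) \<and> (\<forall>x. x \<notin> X_vars s n \<longrightarrow> f x = 0)}"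
  proof clarsimp
    fix m assume m: "m \<in> form_monos s n d i"
    have "Poly_Mapping.lookup m (j, l) \<le> N" if jl: "(j, l) \<in> X_vars s n" for j l
    proof -
      have "Poly_Mapping.lookup m (j, l) \<le> (\<Sum>l\<in>{1..n j + 1}. Poly_Mapping.lookup m (j, l))"
        using jl by (intro member_le_sum) (auto simp: X_vars_def)
      also have "\<dots> = d i j" using m jl by (auto simp: form_monos_def X_vars_def)
      also have "\<dots> \<le> N" unfolding N_def using jl by (intro member_le_sum) (auto simp: X_vars_def)
      finally show ?thesis .
    qed
    then show "(\<forall>x\<in>X_vars s n. Poly_Mapping.lookup m x \<le> N) \<and> (\<forall>a b. (a, b) \<notin> X_vars s n \<longrightarrow> Poly_Mapping.lookup m (a, b) = 0)"
      using m by (auto simp: form_monos_def in_keys_iff)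
  qed
  moreover from this have "finite (Poly_Mapping.lookup ` form_monos s n d i)"
    by (rule finite_subset[OF subset_trans finite_set_of_finite_funs[OF finite_X[of s n] finite_atMost[of N], of 0]]) blast
  ultimately show ?thesis by (metis finite_imageD)
qed

lemma form_mem:
  assumes "i \<in> {1..r}"
  shows "gen_form s n d i \<in> C_set r s n d"
  unfolding gen_form_def C_set_def
proof (intro subringD(8)[OF poly_set_subring[OF A_subring]])
  fix m assume m: "m \<in> form_monos s n d i"
  have "mvar (i, m) \<in> A_set r s n d" unfolding A_set_def
    by (rule mvar_mem) (use m assms in \<open>auto simp: U_vars_def is_subring_UNIV\<close>)
  then show "Poly_Mapping.single m (mvar (i, m)) \<in> poly_set (X_vars s n) (A_set r s n d)"
    using m by (auto simp: poly_set_def form_monos_def split: if_splits)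
qed

lemma dehom_mem:
  assumes "i \<in> {1..r}"
  shows "gen_form_dehom s n d i \<in> Xt_set r s n d"
  unfolding gen_form_dehom_def Xt_set_def
proof (rule meval_mem[OF mconst_hom poly_set_subring[OF A_subring] _ _ form_mem[OF assms, unfolded C_set_def]])
  fix a assume "a \<in> A_set r s n d"
  then show "mconst a \<in> poly_set (Xt_vars s n) (A_set r s n d)" by (rule mconst_mem[OF A_subring])
next
  fix v assume "v \<in> X_vars s n"
  then show "(case v of (j, l) \<Rightarrow> if l = n j + 1 then 1 else mvar (j, l)) \<in> poly_set (Xt_vars s n) (A_set r s n d)"
    by (auto simp: X_vars_def Xt_vars_def split: prod.splits
        intro!: mvar_mem A_subring subringD(2)[OF poly_set_subring[OF A_subring]])
qed

lemma F_exists: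
  "\<exists>F. F \<in> ring_hom (subring_of (AT_set r s n d)) (subring_of (Xt_set r s n d))
    \<and> (\<forall>a\<in>A_set r s n d. F (mconst a) = mconst a)
    \<and> (\<forall>i\<in>{1..r}. F (mvar i) = gen_form_dehom s n d i)"
  apply (rule exI[of _ "meval mconst (gen_form_dehom s n d)"])
  apply (auto simp: meval_mconst[OF mconst_hom] meval_mvar[OF mconst_hom] intro!: ring_homI meval_hom mconst_hom)
  apply (auto simp: Xt_set_def AT_set_def dehom_mem[unfolded Xt_set_def]
     intro!: meval_mem[OF mconst_hom, where V="{1..r}" and R = "A_set r s n d"] poly_set_subring A_subring mconst_mem)
  done

definition Gc where
  "Gc \<sigma> r s n d = meval (\<lambda>k. mconst (mconst k)) (\<lambda>u. if u \<in> eps_var s n d ` {1..r} then mconst (mvar u) + \<sigma> * mvar (fst u) else mconst (mvar u))"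

definition Gx where
  "Gx \<sigma> r s n d = meval (Gc \<sigma> r s n d) mvar"

lemma mm: "comm_ring_hom_ty (\<lambda>k. mconst (mconst k))"
  by (rule comp_hom[OF mconst_hom mconst_hom])
lemma Gc_hom: "comm_ring_hom_ty (Gc \<sigma> r s n d)" unfolding Gc_def by (intro meval_hom mm)
lemma Gx_hom: "comm_ring_hom_ty (Gx \<sigma> r s n d)" unfolding Gx_def by (intro meval_hom Gc_hom)

lemma Gx_simps: "Gx \<sigma> r s n d (mvar i) = mvar i"
  "Gx \<sigma> r s n d (mconst (mconst k)) = mconst (mconst k)"
  "Gx \<sigma> r s n d (mconst (mvar u)) = (if u \<in> eps_var s n d ` {1..r} then mconst (mvar u) + \<sigma> * mvar (fst u) else mconst (mvar u))"
  "Gx \<sigma> r s n d (mconst k') = Gc \<sigma> r s n d k'"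
     apply (simp add: Gx_def meval_mvar[OF Gc_hom])
    apply (simp add: Gx_def meval_mconst[OF Gc_hom])
    apply (simp add: Gc_def meval_mconst[OF mm])
   apply (simp add: Gx_def meval_mconst[OF Gc_hom])
   apply (simp add: Gc_def meval_mvar[OF mm])
  apply (simp add: Gx_def meval_mconst[OF Gc_hom])
  done

lemma Gx_inv:
  assumes "\<sigma> + \<tau> = 0" "\<And>h. comm_ring_hom_ty h \<Longrightarrow> h \<tau> = \<tau>"
  shows "Gx \<sigma> r s n d (Gx \<tau> r s n d p) = p"
proof -
  have 1: "Gx \<sigma> r s n d \<tau> = \<tau>" by (rule assms(2)[OF Gx_hom])
  have 2: "Gx \<sigma> r s n d (Gx \<tau> r s n d (mconst (mvar u))) = mconst (mvar u)" for u
  proof (cases "u \<in> eps_var s n d ` {1..r}")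
    case True
    have "Gx \<sigma> r s n d (Gx \<tau> r s n d (mconst (mvar u))) = mconst (mvar u) + (\<sigma> + \<tau>) * mvar (fst u)"
      by (simp only: True if_True Gx_simps(1,3) homD[OF Gx_hom] 1 distrib_right add.assoc)
    then show ?thesis by (simp add: assms(1))
  qed (simp only: if_False Gx_simps(3))
  have 3: "Gx \<sigma> r s n d (Gx \<tau> r s n d (mconst q)) = mconst q" for q
    by (rule hom_eqI[OF comp_hom[OF Gx_hom comp_hom[OF Gx_hom mconst_hom]] mconst_hom])
       (simp_all only: 2 Gx_simps(2))
  have id: "comm_ring_hom_ty (\<lambda>p. p)" by (simp add: comm_ring_hom_ty_def)
  show ?thesis
    by (rule hom_eqI[OF comp_hom[OF Gx_hom Gx_hom] id]) (simp_all only: 3 Gx_simps(1))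
qed

lemma Gx_mem:
  fixes p :: "(nat, 'k::idom coef) mpol"
  assumes "p \<in> AT_set r s n d" "\<And>S. is_subring S \<Longrightarrow> \<sigma> \<in> S"
  shows "Gx \<sigma> r s n d p \<in> AT_set r s n d"
proof -
  have S: "is_subring (AT_set r s n d)" unfolding AT_set_def by (intro poly_set_subring A_subring)
  have V: "(mvar u :: 'k coef) \<in> A_set r s n d" if "u \<in> U_vars r s n d" for u
    unfolding A_set_def by (rule mvar_mem[OF is_subring_UNIV that])
  have k: "mconst k \<in> A_set r s n d" for k :: 'k unfolding A_set_def by (rule mconst_mem[OF is_subring_UNIV]) simp
  have C: "mconst a \<in> AT_set r s n d" if "a \<in> A_set r s n d" for a :: "'k coef"
    unfolding AT_set_def by (rule mconst_mem[OF A_subring that])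
  have T: "(mvar i :: (nat, 'k coef) mpol) \<in> AT_set r s n d" if "i \<in> {1..r}" for i
    unfolding AT_set_def by (rule mvar_mem[OF A_subring that])
  have "Gc \<sigma> r s n d a \<in> AT_set r s n d" if "a \<in> A_set r s n d" for a :: "'k coef"
    unfolding Gc_def
    apply (rule meval_mem[OF mm S _ _ that[unfolded A_set_def]])
     apply (rule C[OF k])
    apply (auto simp only: split: if_splits intro!: subringD(3,4)[OF S] C V T assms(2) S)
    apply (auto simp: eps_var_def)
    done
  then show ?thesis
    unfolding Gx_def
    by (intro meval_mem[OF Gc_hom S _ _ assms(1)[unfolded AT_set_def]]) (auto intro: T)
qed

lemma G_exists:
  fixes d :: "nat \<Rightarrow> nat \<Rightarrow> nat"
  shows "\<exists>G :: (nat, 'k::idom coef) mpol \<Rightarrow> _. G \<in> ring_iso (subring_of (AT_set r s n d)) (subring_of (AT_set r s n d))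
    \<and> (\<forall>p\<in>A'T_set r s n d. G p = p)
    \<and> (\<forall>i\<in>{1..r}. G (mconst (mvar (eps_var s n d i))) = mconst (mvar (eps_var s n d i)) - mvar i)"
proof (intro exI conjI ballI)
  let ?G = "Gx (-1) r s n d :: (nat, 'k coef) mpol \<Rightarrow> _" and ?H = "Gx 1 r s n d :: (nat, 'k coef) mpol \<Rightarrow> _"
  have gm: "?G p \<in> AT_set r s n d" if "p \<in> AT_set r s n d" for p
    by (rule Gx_mem[OF that]) (auto simp: subringD)
  have hm: "?H p \<in> AT_set r s n d" if "p \<in> AT_set r s n d" for p
    by (rule Gx_mem[OF that]) (auto simp: subringD)
  have "bij_betw ?G (AT_set r s n d) (AT_set r s n d)"
    by (rule bij_betwI[of _ _ _ ?H]) (auto simp: gm hm Gx_inv homD)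
  moreover have "?G \<in> ring_hom (subring_of (AT_set r s n d)) (subring_of (AT_set r s n d))"
    by (intro ring_homI Gx_hom gm)
  ultimately show "?G \<in> ring_iso (subring_of (AT_set r s n d)) (subring_of (AT_set r s n d))"
    by (simp add: ring_iso_def subring_of_def)
  show "?G (mconst (mvar (eps_var s n d i))) = mconst (mvar (eps_var s n d i)) - mvar i" if "i \<in> {1..r}" for i
    using that by (simp add: Gx_simps(3)) (simp add: eps_var_def)
  fix p :: "(nat, 'k coef) mpol" assume p: "p \<in> A'T_set r s n d"
  have c: "?G (mconst a) = mconst a" if "a \<in> A'_set r s n d" for a
  proof -
    have "?G (mconst (\<Sum>m\<in>Poly_Mapping.keys a. Poly_Mapping.single m (Poly_Mapping.lookup a m)))
      = mconst (\<Sum>m\<in>Poly_Mapping.keys a. Poly_Mapping.single m (Poly_Mapping.lookup a m))"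
      unfolding single_eq homD[OF Gx_hom] homD[OF mconst_hom] Gx_simps(1-3)
      by (intro sum.cong prod.cong arg_cong2[of _ _ _ _ "(*)"] arg_cong2[of _ _ _ _ "(^)"] refl)
         (use that in \<open>auto simp: A'_set_def poly_set_def\<close>)
    then show ?thesis using mpol_expand[of a] by simp
  qed
  have "?G (\<Sum>m\<in>Poly_Mapping.keys p. Poly_Mapping.single m (Poly_Mapping.lookup p m))
      = (\<Sum>m\<in>Poly_Mapping.keys p. Poly_Mapping.single m (Poly_Mapping.lookup p m))"
    unfolding single_eq homD[OF Gx_hom] Gx_simps(1)
    by (intro sum.cong arg_cong2[of _ _ _ _ "(*)"] refl c)
       (use p in \<open>auto simp: A'T_set_def poly_set_def\<close>)
  then show "?G p = p" using mpol_expand[of p] by simp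
qed

end

theory Submission
  imports Defs
begin

text \<open>
  Choose one index \<open>\<kappa> j\<close> in each packet, and let $\varepsilon^\kappa_i$ be the coefficient in
  $f_i$ of the pure monomial $\prod_j X_{j,\kappa j}^{d_{i,j}}$.  On the affine chart
  $X_{j,\kappa j} = 1$ the equation $f_i = 0$ reads $\varepsilon^\kappa_i = - t_i$, where $t_i$ is
  the sum of the other dehomogenized terms and does not involve any $\varepsilon^\kappa$.  Hence
  \<open>C / (f)\<close> restricted to the chart is a polynomial ring, and the restriction is the evaluation
  \<open>chart_eval\<close> with $X_{j,\kappa j} \mapsto 1$ and $\varepsilon^\kappa_i \mapsto - t_i$, whose
  restriction to \<open>A\<close> is called \<open>chart_coef\<close>.

  The resultant ideal is the kernel of \<open>chart_coef\<close> for any single chart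
  (\<open>resultant_ideal_eq\<close>), for two reasons.  First, $\sigma_\kappa^N a \in (f)$ for some \<open>N\<close> iff
  \<open>chart_coef a = 0\<close> (\<open>chart_coef_eq_zero_iff\<close>): modulo \<open>(f)\<close>, a high multiple
  $\sigma_\kappa^N a$ is congruent to a multihomogeneous form free of the $\varepsilon^\kappa$, and
  such a form is determined by its restriction to the chart.  Secondly, on every chart each
  $\sigma_\iota$ restricts to a monomial, which is not a zero divisor, so that
  $\sigma_\iota^N a \in (f)$ for one \<open>\<iota>\<close> forces \<open>a\<close> to vanish on all charts
  (\<open>chart_coef_eq_zero\<close>).

  For Perron's formula take the chart at the last index of each packet, write
  $\widetilde f_i = \varepsilon_i + t_i$ and consider $\widetilde F \circ G$ instead of
  $\widetilde F$.  It sends $\varepsilon_i$ to $\varepsilon_i - \widetilde f_i = - t_i$, so it is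
  \<open>chart_coef\<close> on the coefficients, and it sends $T_i$ to $\varepsilon_i + t_i$.  The values
  of \<open>chart_coef\<close> are free of the $\varepsilon_i$, over which the $\varepsilon_i + t_i$ are
  algebraically independent (\<open>meval_chart_form_eq_zero_iff\<close>).  Therefore the kernel of
  $\widetilde F \circ G$ consists of the polynomials all of whose coefficients are killed by
  \<open>chart_coef\<close>, that is, lie in the resultant ideal; and \<open>G\<close> is bijective.
\<close>

section \<open>Subrings, ideals and fractions\<close>

lemma cring_subring_of:
  assumes "is_subring S"
  shows "cring (subring_of S)"
proof (rule cringI)
  note [simp] = subringD[OF assms]
  show "abelian_group (subring_of S)"
  proof (rule abelian_groupI)
    fix x assume "x \<in> carrier (subring_of S)"
    then show "\<exists>y\<in>carrier (subring_of S). y \<oplus>\<^bsub>subring_of S\<^esub> x = \<zero>\<^bsub>subring_of S\<^esub>"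
      by (intro bexI[of _ "- x"]) (auto simp: subring_of_def)
  qed (auto simp: subring_of_def algebra_simps)
  show "comm_monoid (subring_of S)"
    by (rule comm_monoidI) (auto simp: subring_of_def algebra_simps)
qed (auto simp: subring_of_def algebra_simps)

text \<open>This is the usual description of the kernel of \<open>R \<rightarrow> S\<^sup>-\<^sup>1 R\<close>; it turns the
  forms of inertia into a condition on ideal membership alone.\<close>

lemma mk_frac_eq_zero_iff:
  fixes R (structure)
  assumes "cring R" "S \<subseteq> carrier R" "\<one> \<in> S"
    and mult: "\<And>x y. x \<in> S \<Longrightarrow> y \<in> S \<Longrightarrow> x \<otimes> y \<in> S" and a: "a \<in> carrier R"
  shows "mk_frac R S a \<one> = mk_frac R S \<zero> \<one> \<longleftrightarrow> (\<exists>u\<in>S. u \<otimes> a = \<zero>)"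
proof -
  interpret cring R by fact
  have S: "u \<in> S \<Longrightarrow> u \<in> carrier R" for u using assms(2) by blast
  show ?thesis
  proof
    assume eq: "mk_frac R S a \<one> = mk_frac R S \<zero> \<one>"
    have "(a, \<one>) \<in> mk_frac R S a \<one>"
      using a assms(3) by (auto simp: mk_frac_def frac_rel_def)
    then have "((\<zero>, \<one>), (a, \<one>)) \<in> frac_rel R S" unfolding eq by (simp add: mk_frac_def)
    then show "\<exists>u\<in>S. u \<otimes> a = \<zero>" using a S by (force simp: frac_rel_def)
  next
    assume "\<exists>u\<in>S. u \<otimes> a = \<zero>"
    then obtain u where u: "u \<in> S" "u \<otimes> a = \<zero>" by blast
    have "(\<exists>v\<in>S. v \<otimes> (a \<otimes> t) = v \<otimes> (b \<otimes> \<one>)) \<longleftrightarrow> (\<exists>v\<in>S. v \<otimes> (\<zero> \<otimes> t) = v \<otimes> (b \<otimes> \<one>))"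
      if b: "b \<in> carrier R" and t: "t \<in> S" for b t
    proof
      assume "\<exists>v\<in>S. v \<otimes> (a \<otimes> t) = v \<otimes> (b \<otimes> \<one>)"
      then obtain v where v: "v \<in> S" "v \<otimes> (a \<otimes> t) = v \<otimes> (b \<otimes> \<one>)" by blast
      have "(u \<otimes> v) \<otimes> (b \<otimes> \<one>) = u \<otimes> (v \<otimes> (a \<otimes> t))"
        using v(2) u(1) v(1) b S by (simp add: m_assoc)
      also have "\<dots> = (u \<otimes> a) \<otimes> (v \<otimes> t)"
        using u(1) v(1) a t S by (simp add: m_ac)
      finally show "\<exists>v\<in>S. v \<otimes> (\<zero> \<otimes> t) = v \<otimes> (b \<otimes> \<one>)"
        using mult[OF u(1) v(1)] u v t S by (intro bexI[of _ "u \<otimes> v"]) auto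
    next
      assume "\<exists>v\<in>S. v \<otimes> (\<zero> \<otimes> t) = v \<otimes> (b \<otimes> \<one>)"
      then obtain v where v: "v \<in> S" "v \<otimes> b = \<zero>" using b t S by force
      have "(u \<otimes> v) \<otimes> (a \<otimes> t) = (u \<otimes> a) \<otimes> (v \<otimes> t)"
        using u(1) v(1) a t S by (simp add: m_ac)
      moreover have "(u \<otimes> v) \<otimes> (b \<otimes> \<one>) = u \<otimes> (v \<otimes> b)"
        using u(1) v(1) b S by (simp add: m_assoc)
      ultimately show "\<exists>v\<in>S. v \<otimes> (a \<otimes> t) = v \<otimes> (b \<otimes> \<one>)"
        using mult[OF u(1) v(1)] u v t S by (intro bexI[of _ "u \<otimes> v"]) auto
    qed
    note * = this
    have "((a, \<one>), (b, t)) \<in> frac_rel R S \<longleftrightarrow> ((\<zero>, \<one>), (b, t)) \<in> frac_rel R S" for b t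
    proof (cases "b \<in> carrier R \<and> t \<in> S")
      case True
      then show ?thesis using *[of b t] a assms(3) by (simp add: frac_rel_def)
    qed (auto simp: frac_rel_def)
    then show "mk_frac R S a \<one> = mk_frac R S \<zero> \<one>" by (auto simp: mk_frac_def)
  qed
qed

lemma C_subring: "is_subring (C_set r s n d)"
  unfolding C_set_def by (intro poly_set_subring A_subring)

lemma form_ideal_ideal: "ideal (form_ideal r s n d) (subring_of (C_set r s n d))"
proof -
  interpret cring "subring_of (C_set r s n d)" by (intro cring_subring_of C_subring)
  show ?thesis unfolding form_ideal_def
    by (rule genideal_ideal) (auto simp: subring_of_def intro: form_mem)
qed

lemma form_ideal_mem:
  shows "i \<in> {1..r} \<Longrightarrow> gen_form s n d i \<in> form_ideal r s n d"
    and "0 \<in> form_ideal r s n d"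
    and "x \<in> form_ideal r s n d \<Longrightarrow> y \<in> form_ideal r s n d \<Longrightarrow> x + y \<in> form_ideal r s n d"
    and "c \<in> C_set r s n d \<Longrightarrow> x \<in> form_ideal r s n d \<Longrightarrow> c * x \<in> form_ideal r s n d"
proof -
  interpret ideal "form_ideal r s n d" "subring_of (C_set r s n d)" by (rule form_ideal_ideal)
  interpret cring "subring_of (C_set r s n d)" by (intro cring_subring_of C_subring)
  have "gen_form s n d ` {1..r} \<subseteq> carrier (subring_of (C_set r s n d))"
    by (auto simp: subring_of_def intro: form_mem)
  from genideal_self[OF this] show "i \<in> {1..r} \<Longrightarrow> gen_form s n d i \<in> form_ideal r s n d"
    unfolding form_ideal_def by blast
  show "0 \<in> form_ideal r s n d" 
    using additive_subgroup.zero_closed[OF ideal.axioms(1)[OF form_ideal_ideal], of r s n d]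
    by (simp add: subring_of_def)
  show "x \<in> form_ideal r s n d \<Longrightarrow> y \<in> form_ideal r s n d \<Longrightarrow> x + y \<in> form_ideal r s n d"
    using additive_subgroup.a_closed[OF ideal.axioms(1)[OF form_ideal_ideal], of x r s n d y]
    by (simp add: subring_of_def)
  show "c \<in> C_set r s n d \<Longrightarrow> x \<in> form_ideal r s n d \<Longrightarrow> c * x \<in> form_ideal r s n d"
    using I_l_closed[of x c] by (simp add: subring_of_def)
qed

lemma hom_vanishes_on_form_ideal:
  assumes h: "comm_ring_hom_ty h" "\<And>i. i \<in> {1..r} \<Longrightarrow> h (gen_form s n d i) = 0"
    and x: "x \<in> form_ideal r s n d"
  shows "h x = 0"
proof -
  interpret cring "subring_of (C_set r s n d)" by (intro cring_subring_of C_subring)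
  note [simp] = subringD[OF C_subring] homD[OF h(1)]
  let ?J = "{c \<in> C_set r s n d. h c = 0}"
  have inv: "inv\<^bsub>add_monoid (subring_of (C_set r s n d))\<^esub> y = - y" if "y \<in> C_set r s n d" for y
    using that by (intro minus_equality[unfolded a_inv_def]) (auto simp: subring_of_def)
  have "ideal ?J (subring_of (C_set r s n d))"
  proof (rule idealI)
    show "ring (subring_of (C_set r s n d))" by (rule ring_axioms)
    show "subgroup ?J (add_monoid (subring_of (C_set r s n d)))"
      by (rule subgroup.intro) (auto simp: subring_of_def inv[unfolded subring_of_def, simplified])
  qed (auto simp: subring_of_def)
  moreover have "gen_form s n d ` {1..r} \<subseteq> ?J" using h(2) by (auto intro: form_mem)
  ultimately have "form_ideal r s n d \<subseteq> ?J" unfolding form_ideal_def by (rule genideal_minimal)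
  then show ?thesis using x by blast
qed

lemma sigma_mem:
  assumes "\<And>j. j \<in> {1..s} \<Longrightarrow> \<kappa> j \<in> {1..n j + 1}"
  shows "sigma s \<kappa> \<in> C_set r s n d"
  unfolding sigma_def
proof (rule subringD(9)[OF C_subring])
  fix j assume "j \<in> {1..s}"
  then show "mvar (j, \<kappa> j) \<in> C_set r s n d"
    unfolding C_set_def using assms by (intro mvar_mem A_subring) (auto simp: X_vars_def)
qed

lemma inertia_forms_iff:
  fixes c :: "(xvar, 'k::idom coef) mpol"
  shows "c \<in> inertia_forms r s n d \<longleftrightarrow> c \<in> C_set r s n d \<and>
    (\<forall>\<iota>\<in>sigma_indices s n. \<exists>k. sigma s \<iota> ^ k * c \<in> form_ideal r s n d)"
proof (cases "c \<in> C_set r s n d")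
  case False
  then show ?thesis by (simp add: inertia_forms_def)
next
  case c: True
  let ?C = "subring_of (C_set r s n d) :: (xvar, 'k coef) mpol ring"
  let ?I = "form_ideal r s n d :: (xvar, 'k coef) mpol set"
  let ?p = "p_map r s n d :: (xvar, 'k coef) mpol \<Rightarrow> _"
  let ?B = "B_ring r s n d :: (xvar, 'k coef) mpol set ring"
  interpret I: ideal ?I ?C by (rule form_ideal_ideal)
  interpret C: cring ?C by (intro cring_subring_of C_subring)
  interpret B: cring ?B
    unfolding B_ring_def by (rule I.quotient_is_cring) (rule C.cring_axioms)
  have hom: "?p \<in> ring_hom ?C ?B"
    using I.rcos_ring_hom by (simp add: p_map_def[abs_def] B_ring_def)
  have mem: "?p x \<in> carrier ?B" if "x \<in> C_set r s n d" for x
    using ring_hom_closed[OF hom, of x] that by (simp add: subring_of_def)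
  have mult: "?p (x * y) = ?p x \<otimes>\<^bsub>?B\<^esub> ?p y"
    if "x \<in> C_set r s n d" "y \<in> C_set r s n d" for x y
    using ring_hom_mult[OF hom, of x y] that by (simp add: subring_of_def)
  have one: "?p 1 = \<one>\<^bsub>?B\<^esub>" using ring_hom_one[OF hom] by (simp add: subring_of_def)
  have pow: "?p (x ^ k) = ?p x [^]\<^bsub>?B\<^esub> k" if "x \<in> C_set r s n d" for x and k :: nat
    using that by (induction k) (auto simp: one mult subringD[OF C_subring] power_Suc2 simp del: power_Suc)
  have zero: "?p x = \<zero>\<^bsub>?B\<^esub> \<longleftrightarrow> x \<in> ?I" if "x \<in> C_set r s n d" for x
  proof -
    have "?p x = \<zero>\<^bsub>?B\<^esub> \<longleftrightarrow> ?I +>\<^bsub>?C\<^esub> x = ?I" by (simp add: p_map_def B_ring_def FactRing_def)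
    also have "\<dots> \<longleftrightarrow> x \<in> ?I"
      using that I.a_rcos_const[of x] I.a_rcos_self[of x] by (auto simp: subring_of_def)
    finally show ?thesis .
  qed
  have fibre: "mk_frac ?B (sigma_powers r s n d \<iota>) (?p c) \<one>\<^bsub>?B\<^esub>
      = mk_frac ?B (sigma_powers r s n d \<iota>) \<zero>\<^bsub>?B\<^esub> \<one>\<^bsub>?B\<^esub>
    \<longleftrightarrow> (\<exists>k. sigma s \<iota> ^ k * c \<in> ?I)" if \<iota>: "\<iota> \<in> sigma_indices s n" for \<iota>
  proof -
    let ?x = "?p (sigma s \<iota>)"
    have sC: "(sigma s \<iota> :: (xvar, 'k coef) mpol) \<in> C_set r s n d"
      by (rule sigma_mem) (use \<iota> in \<open>auto simp: sigma_indices_def\<close>)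
    have S: "sigma_powers r s n d \<iota> = {?x [^]\<^bsub>?B\<^esub> k | k :: nat. True}"
      by (simp add: sigma_powers_def powers_of_def)
    have Sm: "x \<otimes>\<^bsub>?B\<^esub> y \<in> sigma_powers r s n d \<iota>"
      if "x \<in> sigma_powers r s n d \<iota>" "y \<in> sigma_powers r s n d \<iota>" for x y
      using that by (auto simp: S B.nat_pow_mult mem[OF sC])
    have S1: "\<one>\<^bsub>?B\<^esub> \<in> {?x [^]\<^bsub>?B\<^esub> k | k :: nat. True}"
      by (rule CollectI, rule exI[of _ 0]) simp
    have "mk_frac ?B (sigma_powers r s n d \<iota>) (?p c) \<one>\<^bsub>?B\<^esub>
      = mk_frac ?B (sigma_powers r s n d \<iota>) \<zero>\<^bsub>?B\<^esub> \<one>\<^bsub>?B\<^esub>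
      \<longleftrightarrow> (\<exists>u\<in>sigma_powers r s n d \<iota>. u \<otimes>\<^bsub>?B\<^esub> ?p c = \<zero>\<^bsub>?B\<^esub>)"
      by (rule mk_frac_eq_zero_iff)
        (use S1 Sm mem[OF sC] mem[OF c] B.cring_axioms in \<open>auto simp: S\<close>)
    also have "\<dots> \<longleftrightarrow> (\<exists>k. ?p (sigma s \<iota> ^ k * c) = \<zero>\<^bsub>?B\<^esub>)"
      using c sC by (auto simp: S pow mult subringD[OF C_subring])
    also have "\<dots> \<longleftrightarrow> (\<exists>k. sigma s \<iota> ^ k * c \<in> ?I)"
      using c sC by (simp add: zero subringD[OF C_subring])
    finally show ?thesis .
  qed
  have "c \<in> inertia_forms r s n d \<longleftrightarrow>
      (\<forall>\<iota>\<in>sigma_indices s n. mk_frac ?B (sigma_powers r s n d \<iota>) (?p c) \<one>\<^bsub>?B\<^esub>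
        = mk_frac ?B (sigma_powers r s n d \<iota>) \<zero>\<^bsub>?B\<^esub> \<one>\<^bsub>?B\<^esub>)"
    using c mem[OF c]
    by (auto simp: inertia_forms_def a_kernel_def' pi_map_def loc_product_def product_ring_def
        localization_def fun_eq_iff restrict_def)
  then show ?thesis using c fibre by auto
qed


section \<open>Affine charts\<close>

lemma prod_single: "(\<Prod>v\<in>I. Poly_Mapping.single (f v) (1::'a::comm_ring_1)) = Poly_Mapping.single (\<Sum>v\<in>I. f v) 1"
  for f :: "'i \<Rightarrow> 'm::comm_monoid_add"
  by (induction I rule: infinite_finite_induct) (auto simp: mult_single)

lemma single_power:
  "Poly_Mapping.single m (1::'a::comm_ring_1) ^ k = Poly_Mapping.single (\<Sum>i<k. m) 1"
  for m :: "'m::comm_monoid_add"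
  using prod_single[of "\<lambda>_. m" "{..<k}"] by simp

text \<open>Relabelling monomials injectively cannot cause cancellation.  This serves both for
  multiplication by a monomial and for dehomogenization of multihomogeneous forms.\<close>

lemma sum_single_inj_eq_zero:
  assumes "inj_on f (Poly_Mapping.keys q)"
    and "(\<Sum>t\<in>Poly_Mapping.keys q. Poly_Mapping.single (f t) (Poly_Mapping.lookup q t)) = 0"
  shows "q = 0"
proof (rule ccontr)
  assume "q \<noteq> 0"
  then obtain t where t: "t \<in> Poly_Mapping.keys q" by fastforce
  have "0 = Poly_Mapping.lookup (\<Sum>u\<in>Poly_Mapping.keys q. Poly_Mapping.single (f u) (Poly_Mapping.lookup q u)) (f t)"
    using assms(2) by simp
  also have "\<dots> = (\<Sum>u\<in>Poly_Mapping.keys q. if u = t then Poly_Mapping.lookup q u else 0)"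
    unfolding lookup_sum lookup_single when_def
    by (rule sum.cong) (use t assms(1) in \<open>auto dest: inj_onD\<close>)
  also have "\<dots> = Poly_Mapping.lookup q t" using t by simp
  finally show False using t by (simp add: in_keys_iff)
qed

lemma monomial_mult_eq_zero:
  fixes q :: "('v, 'a::comm_ring_1) mpol"
  assumes "Poly_Mapping.single m 1 * q = 0"
  shows "q = 0"
proof (rule sum_single_inj_eq_zero[of "\<lambda>t. m + t"])
  have "0 = Poly_Mapping.single m 1 * (\<Sum>t\<in>Poly_Mapping.keys q. Poly_Mapping.single t (Poly_Mapping.lookup q t))"
    using assms mpol_expand[of q] by simp
  then show "(\<Sum>t\<in>Poly_Mapping.keys q. Poly_Mapping.single (m + t) (Poly_Mapping.lookup q t)) = 0"
    by (simp add: sum_distrib_left mult_single)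
qed (auto intro: inj_onI)

lemma meval_generators: "meval mconst mvar p = p"
  by (rule hom_eqI[of "meval mconst mvar" "\<lambda>p. p"])
    (auto simp: comm_ring_hom_ty_def meval_mconst[OF mconst_hom] meval_mvar[OF mconst_hom]
      homD[OF meval_hom[OF mconst_hom]])

locale chart =
  fixes r s :: nat and n :: "nat \<Rightarrow> nat" and d :: "nat \<Rightarrow> nat \<Rightarrow> nat" and \<kappa> :: "nat \<Rightarrow> nat"
  assumes \<kappa>: "\<And>j. j \<in> {1..s} \<Longrightarrow> \<kappa> j \<in> {1..n j + 1}"
begin

definition pure :: "(nat \<Rightarrow> nat) \<Rightarrow> (xvar \<Rightarrow>\<^sub>0 nat)" where
  "pure e = (\<Sum>j\<in>{1..s}. Poly_Mapping.single (j, \<kappa> j) (e j))"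

definition block_degree :: "(xvar \<Rightarrow>\<^sub>0 nat) \<Rightarrow> nat \<Rightarrow> nat" where
  "block_degree m j = (\<Sum>l\<in>{1..n j + 1}. Poly_Mapping.lookup m (j, l))"

definition chart_x :: "xvar \<Rightarrow> (xvar, 'k::idom coef) mpol" where
  "chart_x = (\<lambda>(j, l). if l = \<kappa> j then 1 else mvar (j, l))"

text \<open>This is $t_i = \widetilde f_i - \varepsilon^\kappa_i$, the tilde denoting
  dehomogenization with respect to \<open>\<kappa>\<close>.\<close>

definition chart_tail :: "nat \<Rightarrow> (xvar, 'k::idom coef) mpol" where
  "chart_tail i = (\<Sum>m\<in>form_monos s n d i - {pure (d i)}. mconst (mvar (i, m)) * meval_mon chart_x m)"

definition chart_coef :: "'k::idom coef \<Rightarrow> (xvar, 'k coef) mpol" where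
  "chart_coef = meval (\<lambda>k. mconst (mconst k))
    (\<lambda>(i, m). if i \<in> {1..r} \<and> m = pure (d i) then - chart_tail i else mconst (mvar (i, m)))"

definition chart_eval :: "(xvar, 'k::idom coef) mpol \<Rightarrow> (xvar, 'k coef) mpol" where
  "chart_eval = meval chart_coef chart_x"

lemma lookup_pure: "Poly_Mapping.lookup (pure e) (j, l) = (if j \<in> {1..s} \<and> l = \<kappa> j then e j else 0)"
proof -
  have "Poly_Mapping.lookup (pure e) (j, l) = (\<Sum>x\<in>{1..s}. if x = j then (if l = \<kappa> j then e j else 0) else 0)"
    unfolding pure_def lookup_sum by (rule sum.cong) (auto simp: lookup_single when_def)
  then show ?thesis by simp
qed

lemma pure_add: "pure e + pure e' = pure (\<lambda>j. e j + e' j)"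
  by (rule poly_mapping_eqI) (auto simp: lookup_add lookup_pure)

lemma keys_pure: "Poly_Mapping.keys (pure e) \<subseteq> X_vars s n"
  using \<kappa> by (auto simp: in_keys_iff lookup_pure X_vars_def split: if_splits)

lemma block_degree_pure: "j \<in> {1..s} \<Longrightarrow> block_degree (pure e) j = e j"
  using \<kappa>[of j] by (simp add: block_degree_def lookup_pure)

lemma block_degree_add: "block_degree (m + m') j = block_degree m j + block_degree m' j"
  by (simp add: block_degree_def lookup_add sum.distrib)

lemma form_monos_iff:
  "m \<in> form_monos s n d i \<longleftrightarrow> Poly_Mapping.keys m \<subseteq> X_vars s n \<and> (\<forall>j\<in>{1..s}. block_degree m j = d i j)"
  by (simp add: form_monos_def block_degree_def)

lemma pure_form_mono: "pure (d i) \<in> form_monos s n d i"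
  using keys_pure block_degree_pure by (simp add: form_monos_iff)

lemma chart_coef_hom: "comm_ring_hom_ty chart_coef"
  unfolding chart_coef_def by (intro meval_hom mm)

lemma chart_eval_hom: "comm_ring_hom_ty chart_eval"
  unfolding chart_eval_def by (intro meval_hom chart_coef_hom)

lemma chart_eval_mconst: "chart_eval (mconst a) = chart_coef a"
  by (simp add: chart_eval_def meval_mconst[OF chart_coef_hom])

lemma chart_coef_mconst: "chart_coef (mconst k) = mconst (mconst k)"
  by (simp add: chart_coef_def meval_mconst[OF mm])

lemma chart_coef_mvar: "chart_coef (mvar (i, m)) =
    (if i \<in> {1..r} \<and> m = pure (d i) then - chart_tail i else mconst (mvar (i, m)))"
  by (simp add: chart_coef_def meval_mvar[OF mm])

lemma meval_mon_pure: "meval_mon chart_x (pure e) = 1"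
  unfolding meval_mon_def
  by (rule prod.neutral) (auto simp: in_keys_iff lookup_pure chart_x_def split: if_splits)

lemma sigma_power: "sigma s \<kappa> ^ N = Poly_Mapping.single (pure (\<lambda>_. N)) 1"
proof (induction N)
  case 0
  have "pure (\<lambda>_. 0) = 0" by (simp add: pure_def)
  then show ?case by simp
next
  case (Suc N)
  have "(sigma s \<kappa> :: (xvar, 'a coef) mpol) = Poly_Mapping.single (pure (\<lambda>_. 1)) 1"
    by (simp add: sigma_def pure_def mvar_def prod_single)
  then show ?case unfolding power_Suc Suc by (simp add: mult_single pure_add)
qed

lemma chart_eval_gen_form:
  assumes "i \<in> {1..r}"
  shows "chart_eval (gen_form s n d i) = 0"
proof -
  have "chart_eval (gen_form s n d i)
      = (\<Sum>m\<in>form_monos s n d i. chart_coef (mvar (i, m)) * meval_mon chart_x m)"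
    unfolding gen_form_def homD[OF chart_eval_hom]
    by (simp add: chart_eval_def meval_single[OF chart_coef_hom])
  also have "\<dots> = - chart_tail i + chart_tail i"
    unfolding sum.remove[OF form_monos_finite pure_form_mono]
    using assms by (simp add: chart_coef_mvar meval_mon_pure chart_tail_def)
  finally show ?thesis by simp
qed

lemma chart_eval_form_ideal: "x \<in> form_ideal r s n d \<Longrightarrow> chart_eval x = 0"
  by (rule hom_vanishes_on_form_ideal[OF chart_eval_hom chart_eval_gen_form])

lemma chart_x_monomial: "\<exists>m. chart_x v = Poly_Mapping.single m 1"
proof (cases "snd v = \<kappa> (fst v)")
  case True
  then show ?thesis by (intro exI[of _ 0]) (auto simp: chart_x_def split: prod.split)
qed (auto simp: chart_x_def mvar_def split: prod.split)

lemma chart_eval_sigma_monomial: "\<exists>m. chart_eval (sigma s \<iota> ^ N) = Poly_Mapping.single m 1"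
proof -
  obtain f where f: "\<And>v. (chart_x v :: (xvar, 'a coef) mpol) = Poly_Mapping.single (f v) 1"
    using chart_x_monomial by metis
  have "(chart_eval (sigma s \<iota> ^ N) :: (xvar, 'a coef) mpol) = (\<Prod>j\<in>{1..s}. chart_x (j, \<iota> j)) ^ N"
    unfolding sigma_def homD[OF chart_eval_hom]
    by (simp add: chart_eval_def meval_mvar[OF chart_coef_hom])
  then show ?thesis by (auto simp: f prod_single single_power)
qed

definition affine_part :: "(xvar \<Rightarrow>\<^sub>0 nat) \<Rightarrow> (xvar \<Rightarrow>\<^sub>0 nat)" where
  "affine_part m = (\<Sum>v\<in>Poly_Mapping.keys m.
     if snd v = \<kappa> (fst v) then 0 else Poly_Mapping.single v (Poly_Mapping.lookup m v))"

lemma lookup_affine_part: "Poly_Mapping.lookup (affine_part m) v =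
    (if snd v = \<kappa> (fst v) then 0 else Poly_Mapping.lookup m v)"
proof -
  have "Poly_Mapping.lookup (affine_part m) v = (\<Sum>w\<in>Poly_Mapping.keys m.
      if w = v then (if snd v = \<kappa> (fst v) then 0 else Poly_Mapping.lookup m v) else 0)"
    unfolding affine_part_def lookup_sum by (rule sum.cong) (auto simp: lookup_single when_def)
  then show ?thesis by (auto simp: in_keys_iff)
qed

lemma meval_mon_chart_x: "meval_mon chart_x m = Poly_Mapping.single (affine_part m) 1"
proof -
  have p: "mvar v ^ k = Poly_Mapping.single (Poly_Mapping.single v k) 1" for v :: xvar and k
    by (induction k) (auto simp: mvar_def mult_single single_add[symmetric])
  have "(chart_x v :: (xvar, 'a coef) mpol) ^ Poly_Mapping.lookup m v = Poly_Mapping.single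
      (if snd v = \<kappa> (fst v) then 0 else Poly_Mapping.single v (Poly_Mapping.lookup m v)) 1" for v
    by (cases v) (auto simp: chart_x_def p)
  then show ?thesis by (simp add: meval_mon_def affine_part_def prod_single)
qed

text \<open>Within a packet the exponent of the variable that is set to \<open>1\<close> can be recovered from
  the total degree.\<close>

lemma inj_on_affine_part:
  "inj_on affine_part {m. Poly_Mapping.keys m \<subseteq> X_vars s n \<and> (\<forall>j\<in>{1..s}. block_degree m j = N)}"
proof (rule inj_onI, clarify)
  fix m m' assume eq: "affine_part m = affine_part m'"
    and X: "Poly_Mapping.keys m \<subseteq> X_vars s n" "Poly_Mapping.keys m' \<subseteq> X_vars s n"
    and deg: "\<forall>j\<in>{1..s}. block_degree m j = N" "\<forall>j\<in>{1..s}. block_degree m' j = N"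
  have off: "Poly_Mapping.lookup m (j, l) = Poly_Mapping.lookup m' (j, l)" if "l \<noteq> \<kappa> j" for j l
    using arg_cong[OF eq, of "\<lambda>p. Poly_Mapping.lookup p (j, l)"] that by (simp add: lookup_affine_part)
  have on: "Poly_Mapping.lookup m (j, \<kappa> j) = Poly_Mapping.lookup m' (j, \<kappa> j)" for j
  proof (cases "j \<in> {1..s}")
    case True
    have "block_degree p j = Poly_Mapping.lookup p (j, \<kappa> j)
        + (\<Sum>l\<in>{1..n j + 1} - {\<kappa> j}. Poly_Mapping.lookup p (j, l))" for p
      unfolding block_degree_def by (rule sum.remove) (use \<kappa>[OF True] in auto)
    moreover have "(\<Sum>l\<in>{1..n j + 1} - {\<kappa> j}. Poly_Mapping.lookup m (j, l))
        = (\<Sum>l\<in>{1..n j + 1} - {\<kappa> j}. Poly_Mapping.lookup m' (j, l))"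
      by (rule sum.cong) (auto simp: off)
    ultimately show ?thesis using deg True by (metis add_right_cancel)
  next
    case False
    then have "(j, \<kappa> j) \<notin> X_vars s n" by (auto simp: X_vars_def)
    then show ?thesis using X by (metis in_keys_iff subsetD)
  qed
  show "m = m'" by (rule poly_mapping_eqI) (metis off on surj_pair)
qed

section \<open>Elimination of the pure coefficients\<close>

text \<open>An element of \<open>A\<close> is fixed by \<open>chart_coef\<close> as soon as it involves no
  $\varepsilon^\kappa_i$.  Describing these elements by the fixed-point equation makes closure under
  the ring operations immediate.\<close>

definition chart_consts :: "'k::idom coef set" where
  "chart_consts = {a \<in> A_set r s n d. chart_coef a = mconst a}"

definition chart_forms :: "nat \<Rightarrow> (xvar, 'k::idom coef) mpol set" where
  "chart_forms N = {h \<in> poly_set (X_vars s n) chart_consts.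
     \<forall>m\<in>Poly_Mapping.keys h. \<forall>j\<in>{1..s}. block_degree m j = N}"

lemma chart_consts_subring: "is_subring chart_consts"
  using subringD[OF A_subring]
  by (auto simp: is_subring_def chart_consts_def homD[OF chart_coef_hom] homD[OF mconst_hom])

lemma chart_forms_poly_set: "h \<in> chart_forms N \<Longrightarrow> h \<in> poly_set (X_vars s n) chart_consts"
  by (simp add: chart_forms_def)

lemma chart_forms_C: "h \<in> chart_forms N \<Longrightarrow> h \<in> C_set r s n d"
  by (auto simp: chart_forms_def C_set_def poly_set_def chart_consts_def)

lemma chart_forms_add: "g \<in> chart_forms N \<Longrightarrow> h \<in> chart_forms N \<Longrightarrow> g + h \<in> chart_forms N"
  using keys_add[of g h] subringD(3)[OF poly_set_subring[OF chart_consts_subring]]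
  unfolding chart_forms_def by blast

lemma chart_forms_uminus: "h \<in> chart_forms N \<Longrightarrow> - h \<in> chart_forms N"
  using subringD(5)[OF poly_set_subring[OF chart_consts_subring], of h]
  unfolding chart_forms_def by auto

lemma chart_forms_sum:
  "(\<And>i. i \<in> I \<Longrightarrow> f i \<in> chart_forms N) \<Longrightarrow> sum f I \<in> chart_forms N"
proof (induction I rule: infinite_finite_induct)
  case (insert x F)
  then show ?case by (simp add: chart_forms_add)
qed (auto simp: chart_forms_def poly_set_def)

lemma chart_forms_mult:
  assumes "g \<in> chart_forms M" "h \<in> chart_forms N"
  shows "g * h \<in> chart_forms (M + N)"
  unfolding chart_forms_def
proof (intro CollectI conjI ballI)
  show "g * h \<in> poly_set (X_vars s n) chart_consts"
    using assms chart_forms_poly_set subringD(4)[OF poly_set_subring[OF chart_consts_subring]] by blast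
  fix m j assume "m \<in> Poly_Mapping.keys (g * h)" and j: "j \<in> {1..s}"
  then obtain a b where "m = a + b" "a \<in> Poly_Mapping.keys g" "b \<in> Poly_Mapping.keys h"
    using keys_mult[of g h] by blast
  then show "block_degree m j = M + N"
    using assms j by (simp add: chart_forms_def block_degree_add)
qed

lemma single_chart_forms:
  assumes "a \<in> chart_consts" "Poly_Mapping.keys m \<subseteq> X_vars s n"
    "\<And>j. j \<in> {1..s} \<Longrightarrow> block_degree m j = N"
  shows "Poly_Mapping.single m a \<in> chart_forms N"
  using assms by (auto simp: chart_forms_def poly_set_def split: if_splits)

lemma sigma_power_chart_forms: "sigma s \<kappa> ^ N \<in> chart_forms N"
  unfolding sigma_power
  by (rule single_chart_forms)
    (use subringD(2)[OF chart_consts_subring] keys_pure block_degree_pure in auto)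

text \<open>On a form with coefficients in \<open>chart_consts\<close>, evaluation on the chart merely
  dehomogenizes, and this loses no information on multihomogeneous forms.\<close>

lemma chart_form_eq_zero:
  assumes h: "h \<in> chart_forms N" and zero: "chart_eval h = 0"
  shows "h = 0"
proof (rule sum_single_inj_eq_zero[of affine_part])
  show "inj_on affine_part (Poly_Mapping.keys h)"
    by (rule inj_on_subset[OF inj_on_affine_part[of N]])
      (use h in \<open>auto simp: chart_forms_def poly_set_def\<close>)
  have "chart_eval h = (\<Sum>m\<in>Poly_Mapping.keys h. mconst (Poly_Mapping.lookup h m) * meval_mon chart_x m)"
    unfolding chart_eval_def meval_alt
    by (rule sum.cong) (use h in \<open>auto simp: chart_forms_def poly_set_def chart_consts_def\<close>)
  then show "(\<Sum>m\<in>Poly_Mapping.keys h. Poly_Mapping.single (affine_part m) (Poly_Mapping.lookup h m)) = 0"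
    using zero by (simp add: meval_mon_chart_x mconst_def mult_single)
qed

text \<open>Elements of \<open>A\<close> from which the $\varepsilon^\kappa_i$ can be eliminated modulo the
  forms after multiplication by a power of $\sigma_\kappa$.  They form a subring, so it suffices to
  treat the indeterminates of \<open>A\<close>.\<close>

definition chart_reducible :: "'k::idom coef set" where
  "chart_reducible = {a \<in> A_set r s n d. \<exists>N. \<exists>h\<in>chart_forms N. sigma s \<kappa> ^ N * mconst a - h \<in> form_ideal r s n d}"

lemma chart_reducibleI:
  "a \<in> A_set r s n d \<Longrightarrow> h \<in> chart_forms N \<Longrightarrow> sigma s \<kappa> ^ N * mconst a - h \<in> form_ideal r s n d
    \<Longrightarrow> a \<in> chart_reducible"
  by (auto simp: chart_reducible_def)

lemma chart_reducible_subring: "is_subring chart_reducible"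
  unfolding is_subring_def
proof (intro conjI ballI)
  note C = subringD[OF C_subring] and A = subringD[OF A_subring]
  have sC: "sigma s \<kappa> ^ N \<in> C_set r s n d" for N
    by (rule chart_forms_C[OF sigma_power_chart_forms])
  have AC: "mconst a \<in> C_set r s n d" if "a \<in> A_set r s n d" for a
    unfolding C_set_def by (rule mconst_mem[OF A_subring that])
  show "1 \<in> chart_reducible"
    by (rule chart_reducibleI[OF A(2) sigma_power_chart_forms[of 0]])
      (simp add: homD[OF mconst_hom] form_ideal_mem(2))
  fix x y :: "'a coef" assume "x \<in> chart_reducible" "y \<in> chart_reducible"
  then obtain M N g h where x: "x \<in> A_set r s n d" "g \<in> chart_forms M"
      "sigma s \<kappa> ^ M * mconst x - g \<in> form_ideal r s n d"
    and y: "y \<in> A_set r s n d" "h \<in> chart_forms N"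
      "sigma s \<kappa> ^ N * mconst y - h \<in> form_ideal r s n d"
    by (auto simp: chart_reducible_def)
  show "x + y \<in> chart_reducible"
  proof (rule chart_reducibleI[OF A(3)[OF x(1) y(1)]])
    show "sigma s \<kappa> ^ N * g + sigma s \<kappa> ^ M * h \<in> chart_forms (M + N)"
      using chart_forms_add[OF chart_forms_mult[OF x(2) sigma_power_chart_forms[of N]]
          chart_forms_mult[OF sigma_power_chart_forms[of M] y(2)]]
      by (simp add: mult.commute)
    have "sigma s \<kappa> ^ (M + N) * mconst (x + y) - (sigma s \<kappa> ^ N * g + sigma s \<kappa> ^ M * h)
      = sigma s \<kappa> ^ N * (sigma s \<kappa> ^ M * mconst x - g) + sigma s \<kappa> ^ M * (sigma s \<kappa> ^ N * mconst y - h)"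
      by (simp add: homD[OF mconst_hom] power_add algebra_simps)
    also have "\<dots> \<in> form_ideal r s n d"
      by (intro form_ideal_mem(3,4) sC x y)
    finally show "sigma s \<kappa> ^ (M + N) * mconst (x + y) - (sigma s \<kappa> ^ N * g + sigma s \<kappa> ^ M * h)
      \<in> form_ideal r s n d" .
  qed
  show "x * y \<in> chart_reducible"
  proof (rule chart_reducibleI[OF A(4)[OF x(1) y(1)] chart_forms_mult[OF x(2) y(2)]])
    have "sigma s \<kappa> ^ (M + N) * mconst (x * y) - g * h
      = (sigma s \<kappa> ^ N * mconst y) * (sigma s \<kappa> ^ M * mconst x - g) + g * (sigma s \<kappa> ^ N * mconst y - h)"
      by (simp add: homD[OF mconst_hom] power_add algebra_simps)
    also have "\<dots> \<in> form_ideal r s n d"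
      by (intro form_ideal_mem(3,4) C(4) sC AC x y chart_forms_C[OF x(2)])
    finally show "sigma s \<kappa> ^ (M + N) * mconst (x * y) - g * h \<in> form_ideal r s n d" .
  qed
  show "- x \<in> chart_reducible"
  proof (rule chart_reducibleI[OF A(5)[OF x(1)] chart_forms_uminus[OF x(2)]])
    have "sigma s \<kappa> ^ M * mconst (- x) - - g = (- 1) * (sigma s \<kappa> ^ M * mconst x - g)"
      by (simp add: homD[OF mconst_hom])
    also have "\<dots> \<in> form_ideal r s n d" by (intro form_ideal_mem(4) x C(5,2))
    finally show "sigma s \<kappa> ^ M * mconst (- x) - - g \<in> form_ideal r s n d" .
  qed
qed

lemma chart_consts_reducible:
  assumes "a \<in> chart_consts"
  shows "a \<in> chart_reducible"
proof (rule chart_reducibleI)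
  show "a \<in> A_set r s n d" using assms by (simp add: chart_consts_def)
  show "mconst a \<in> chart_forms 0"
    unfolding mconst_def by (rule single_chart_forms[OF assms]) (auto simp: block_degree_def)
qed (simp add: form_ideal_mem(2))

text \<open>Only $\varepsilon^\kappa_i$ needs an argument: multiplying $f_i$ by a pure monomial turns
  its term $\varepsilon^\kappa_i \prod_j X_{j,\kappa j}^{d_{i,j}}$ into
  $\sigma_\kappa^D \varepsilon^\kappa_i$, and the other terms are free of the
  $\varepsilon^\kappa$.\<close>

lemma U_var_reducible:
  assumes u: "(i, m) \<in> U_vars r s n d"
  shows "mvar (i, m) \<in> chart_reducible"
proof -
  have i: "i \<in> {1..r}" using u by (simp add: U_vars_def)
  have A: "mvar (i, m) \<in> A_set r s n d" if "m \<in> form_monos s n d i" for m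
    unfolding A_set_def by (rule mvar_mem[OF is_subring_UNIV]) (use that i in \<open>auto simp: U_vars_def\<close>)
  have const: "mvar (i, m) \<in> chart_consts" if "m \<in> form_monos s n d i" "m \<noteq> pure (d i)" for m
    using that A by (simp add: chart_consts_def chart_coef_mvar)
  show ?thesis
  proof (cases "m = pure (d i)")
    case False
    then show ?thesis using const u by (auto simp: U_vars_def intro: chart_consts_reducible)
  next
    case True
    \<comment> \<open>The degrees of $f_i$ may differ between packets, whereas a power of \<open>sigma\<close> has the
      same degree in each; so a common upper bound is needed.\<close>
    define D where "D = (\<Sum>j\<in>{1..s}. d i j)"
    have D: "d i j \<le> D" if "j \<in> {1..s}" for j
      unfolding D_def using that by (intro member_le_sum) auto
    define c where "c = pure (\<lambda>j. D - d i j)"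
    define h :: "(xvar, 'a coef) mpol" where
      "h = (\<Sum>m\<in>form_monos s n d i - {pure (d i)}. Poly_Mapping.single (c + m) (mvar (i, m)))"
    show ?thesis
    proof (rule chart_reducibleI)
      show "mvar (i, m) \<in> A_set r s n d" using A u by (auto simp: U_vars_def)
      show "- h \<in> chart_forms D"
        unfolding h_def
      proof (intro chart_forms_uminus chart_forms_sum single_chart_forms)
        fix m assume m: "m \<in> form_monos s n d i - {pure (d i)}"
        then show "mvar (i, m) \<in> chart_consts" using const by blast
        show "Poly_Mapping.keys (c + m) \<subseteq> X_vars s n"
          using m keys_pure by (auto simp: keys_mon_add c_def form_monos_iff)
        show "block_degree (c + m) j = D" if "j \<in> {1..s}" for j
          using m that D[OF that] by (auto simp: block_degree_add c_def block_degree_pure form_monos_iff)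
      qed
      have "c + pure (d i) = pure (\<lambda>_. D)"
        unfolding c_def pure_add unfolding pure_def by (rule sum.cong) (use D in auto)
      then have "sigma s \<kappa> ^ D * mconst (mvar (i, m)) - (- h)
          = Poly_Mapping.single (c + pure (d i)) (mvar (i, m)) + h"
        by (simp add: sigma_power mconst_def mult_single)
      also have "\<dots> = (\<Sum>m\<in>form_monos s n d i. Poly_Mapping.single (c + m) (mvar (i, m)))"
        unfolding sum.remove[OF form_monos_finite pure_form_mono] h_def True ..
      also have "\<dots> = Poly_Mapping.single c 1 * gen_form s n d i"
        by (simp add: gen_form_def sum_distrib_left mult_single)
      also have "\<dots> \<in> form_ideal r s n d"
      proof (rule form_ideal_mem(4)[OF _ form_ideal_mem(1)[OF i]])
        show "Poly_Mapping.single c 1 \<in> C_set r s n d"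
          using keys_pure[of "\<lambda>j. D - d i j"] subringD(2)[OF A_subring]
          by (auto simp: C_set_def poly_set_def c_def split: if_splits)
      qed
      finally show "sigma s \<kappa> ^ D * mconst (mvar (i, m)) - - h \<in> form_ideal r s n d" .
    qed
  qed
qed

lemma A_reducible:
  assumes "a \<in> A_set r s n d"
  shows "a \<in> chart_reducible"
proof -
  have "meval mconst mvar a \<in> chart_reducible"
  proof (rule meval_mem[OF mconst_hom chart_reducible_subring _ _ assms[unfolded A_set_def]])
    show "mconst k \<in> chart_reducible" for k
      by (rule chart_consts_reducible)
        (simp add: chart_consts_def A_set_def mconst_mem[OF is_subring_UNIV] chart_coef_mconst)
  qed (auto intro: U_var_reducible)
  then show ?thesis unfolding meval_generators .
qed

lemma chart_coef_eq_zero_iff: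
  assumes a: "a \<in> A_set r s n d"
  shows "chart_coef a = 0 \<longleftrightarrow> (\<exists>N. sigma s \<kappa> ^ N * mconst a \<in> form_ideal r s n d)"
proof
  obtain N h where h: "h \<in> chart_forms N" "sigma s \<kappa> ^ N * mconst a - h \<in> form_ideal r s n d"
    using A_reducible[OF a] by (auto simp: chart_reducible_def)
  assume "chart_coef a = 0"
  then have "chart_eval h = 0"
    using chart_eval_form_ideal[OF h(2)] by (simp add: homD[OF chart_eval_hom] chart_eval_mconst)
  with h show "\<exists>N. sigma s \<kappa> ^ N * mconst a \<in> form_ideal r s n d"
    using chart_form_eq_zero by fastforce
next
  assume "\<exists>N. sigma s \<kappa> ^ N * mconst a \<in> form_ideal r s n d"
  then obtain N where "sigma s \<kappa> ^ N * mconst a \<in> form_ideal r s n d" ..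
  then have "chart_eval (sigma s \<kappa> ^ N * mconst a) = 0" by (rule chart_eval_form_ideal)
  moreover have "chart_eval (sigma s \<kappa> ^ N) = (1 :: (xvar, 'a coef) mpol)"
    unfolding sigma_power chart_eval_def
    by (simp add: meval_single[OF chart_coef_hom] homD[OF chart_coef_hom] meval_mon_pure)
  ultimately show "chart_coef a = 0" by (simp add: homD(4)[OF chart_eval_hom] chart_eval_mconst)
qed

text \<open>Here \<open>\<iota>\<close> need not be the index of the chart: vanishing outside the divisor
  $\sigma_\iota = 0$ is vanishing on every chart, since $\sigma_\iota$ is a monomial there.\<close>

lemma chart_coef_eq_zero:
  assumes "sigma s \<iota> ^ N * mconst a \<in> form_ideal r s n d"
  shows "chart_coef a = 0"
proof -
  obtain m where "chart_eval (sigma s \<iota> ^ N) = Poly_Mapping.single m (1 :: 'a coef)"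
    using chart_eval_sigma_monomial by blast
  then have "Poly_Mapping.single m 1 * chart_coef a = 0"
    using chart_eval_form_ideal[OF assms] by (simp add: homD(4)[OF chart_eval_hom] chart_eval_mconst)
  then show ?thesis by (rule monomial_mult_eq_zero)
qed

end


section \<open>Perron's formula\<close>

lemma resultant_ideal_eq:
  "(a \<in> resultant_ideal r s n d) \<longleftrightarrow> a \<in> A_set r s n d \<and> chart.chart_coef r s n d (\<lambda>j. n j + 1) a = 0"
proof (cases "a \<in> A_set r s n d")
  case a: True
  let ?top = "\<lambda>j. n j + 1"
  interpret top: chart r s n d ?top by unfold_locales auto
  have aC: "mconst a \<in> C_set r s n d" unfolding C_set_def by (rule mconst_mem[OF A_subring a])
  have "(\<forall>\<iota>\<in>sigma_indices s n. \<exists>k. sigma s \<iota> ^ k * mconst a \<in> form_ideal r s n d)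
      \<longleftrightarrow> top.chart_coef a = 0"
  proof
    assume all: "\<forall>\<iota>\<in>sigma_indices s n. \<exists>k. sigma s \<iota> ^ k * mconst a \<in> form_ideal r s n d"
    have "restrict ?top {1..s} \<in> sigma_indices s n" by (auto simp: sigma_indices_def)
    with all show "top.chart_coef a = 0" by (blast intro: top.chart_coef_eq_zero)
  next
    assume "top.chart_coef a = 0"
    then obtain N where N: "sigma s ?top ^ N * mconst a \<in> form_ideal r s n d"
      using top.chart_coef_eq_zero_iff[OF a] by blast
    show "\<forall>\<iota>\<in>sigma_indices s n. \<exists>k. sigma s \<iota> ^ k * mconst a \<in> form_ideal r s n d"
    proof
      fix \<iota> assume "\<iota> \<in> sigma_indices s n"
      then interpret \<iota>: chart r s n d \<iota> by unfold_locales (auto simp: sigma_indices_def)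
      show "\<exists>k. sigma s \<iota> ^ k * mconst a \<in> form_ideal r s n d"
        using \<iota>.chart_coef_eq_zero_iff[OF a] \<iota>.chart_coef_eq_zero[OF N] by blast
    qed
  qed
  then show ?thesis using a aC by (simp add: resultant_ideal_def inertia_forms_iff)
qed (simp add: resultant_ideal_def)

lemma hom_meval:
  assumes "comm_ring_hom_ty h"
  shows "h (meval \<phi> x p) = meval (\<lambda>a. h (\<phi> a)) (\<lambda>v. h (x v)) p"
  by (simp add: meval_def homD[OF assms])

text \<open>The hypotheses on \<open>h\<close> concern the carrier \<open>S[V]\<close> only; on it \<open>h\<close> is
  identified with an evaluation, for which the identities hold on the whole type.\<close>

lemma hom_on_poly_set:
  fixes p :: "('v, 'a::comm_ring_1) mpol" and h :: "('v, 'a) mpol \<Rightarrow> 'b::comm_ring_1"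
  assumes S: "is_subring S"
    and h: "h \<in> ring_hom (subring_of (poly_set V S)) (subring_of T)"
    and p: "p \<in> poly_set V S"
  shows "h p = meval (\<lambda>a. h (mconst a)) (\<lambda>v. h (mvar v)) p"
proof -
  note R = subringD[OF poly_set_subring[OF S]]
  have h1: "h 1 = 1" using ring_hom_one[OF h] by (simp add: subring_of_def)
  have hadd: "h (x + y) = h x + h y" if "x \<in> poly_set V S" "y \<in> poly_set V S" for x y
    using ring_hom_add[OF h, of x y] that by (simp add: subring_of_def)
  have hmult: "h (x * y) = h x * h y" if "x \<in> poly_set V S" "y \<in> poly_set V S" for x y
    using ring_hom_mult[OF h, of x y] that by (simp add: subring_of_def)
  have h0: "h 0 = 0" using hadd[OF R(1,1)] by simp
  have hsum: "h (\<Sum>i\<in>I. f i) = (\<Sum>i\<in>I. h (f i))" if "\<And>i. i \<in> I \<Longrightarrow> f i \<in> poly_set V S" for I :: "('v \<Rightarrow>\<^sub>0 nat) set" and f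
    using that by (induction I rule: infinite_finite_induct) (auto simp: h0 hadd R)
  have hprod: "h (\<Prod>i\<in>I. f i) = (\<Prod>i\<in>I. h (f i))" if "\<And>i. i \<in> I \<Longrightarrow> f i \<in> poly_set V S" for I :: "'v set" and f
    using that by (induction I rule: infinite_finite_induct) (auto simp: h1 hmult R)
  have hpow: "h (x ^ k) = h x ^ k" if "x \<in> poly_set V S" for x k
    using that by (induction k) (auto simp: h1 hmult R)
  have coef: "mconst (Poly_Mapping.lookup p m) \<in> poly_set V S" if "m \<in> Poly_Mapping.keys p" for m
    using p that by (intro mconst_mem[OF S]) (auto simp: poly_set_def)
  have var: "mvar v \<in> poly_set V S" if "m \<in> Poly_Mapping.keys p" "v \<in> Poly_Mapping.keys m" for m v
    using p that by (intro mvar_mem[OF S]) (auto simp: poly_set_def)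
  have mon: "(\<Prod>v\<in>Poly_Mapping.keys m. mvar v ^ Poly_Mapping.lookup m v) \<in> poly_set V S"
    if "m \<in> Poly_Mapping.keys p" for m
    by (intro R var[OF that])
  have "h p = h (\<Sum>m\<in>Poly_Mapping.keys p. Poly_Mapping.single m (Poly_Mapping.lookup p m))"
    using mpol_expand[of p] by simp
  also have "\<dots> = (\<Sum>m\<in>Poly_Mapping.keys p. h (mconst (Poly_Mapping.lookup p m)
      * (\<Prod>v\<in>Poly_Mapping.keys m. mvar v ^ Poly_Mapping.lookup m v)))"
    unfolding single_eq by (rule hsum) (intro R(4) coef mon)
  also have "\<dots> = meval (\<lambda>a. h (mconst a)) (\<lambda>v. h (mvar v)) p"
    unfolding meval_def
  proof (rule sum.cong[OF refl])
    fix m assume m: "m \<in> Poly_Mapping.keys p"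
    have "h (\<Prod>v\<in>Poly_Mapping.keys m. mvar v ^ Poly_Mapping.lookup m v)
        = (\<Prod>v\<in>Poly_Mapping.keys m. h (mvar v ^ Poly_Mapping.lookup m v))"
      by (rule hprod) (intro R(7) var[OF m])
    also have "\<dots> = (\<Prod>v\<in>Poly_Mapping.keys m. h (mvar v) ^ Poly_Mapping.lookup m v)"
      by (intro prod.cong refl hpow var[OF m])
    finally show "h (mconst (Poly_Mapping.lookup p m)
        * (\<Prod>v\<in>Poly_Mapping.keys m. mvar v ^ Poly_Mapping.lookup m v))
      = h (mconst (Poly_Mapping.lookup p m)) * (\<Prod>v\<in>Poly_Mapping.keys m. h (mvar v) ^ Poly_Mapping.lookup m v)"
      by (simp add: hmult coef mon m)
  qed
  finally show ?thesis .
qed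

context chart
begin

definition chart_form :: "nat \<Rightarrow> (xvar, 'k::idom coef) mpol" where
  "chart_form i = mconst (mvar (i, pure (d i))) + chart_tail i"

lemma meval_gen_form: "meval mconst chart_x (gen_form s n d i) = chart_form i"
proof -
  have "meval mconst chart_x (gen_form s n d i)
      = (\<Sum>m\<in>form_monos s n d i. mconst (mvar (i, m)) * meval_mon chart_x m)"
    unfolding gen_form_def homD[OF meval_hom[OF mconst_hom]]
    by (simp add: meval_single[OF mconst_hom])
  then show ?thesis
    unfolding sum.remove[OF form_monos_finite pure_form_mono]
    by (simp add: chart_tail_def meval_mon_pure chart_form_def)
qed

text \<open>The map with $\varepsilon^\kappa_i \mapsto T_i - t_i$ witnesses the algebraic independence
  of the $\widetilde f_i = \varepsilon^\kappa_i + t_i$: it sends $\widetilde f_i$ back to $T_i$ and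
  fixes everything that is free of the $\varepsilon^\kappa$, in particular the values of
  \<open>chart_coef\<close>.\<close>

definition untwist :: "(xvar, 'k::idom coef) mpol \<Rightarrow> (nat, (xvar, 'k coef) mpol) mpol" where
  "untwist = meval
     (meval (\<lambda>k. mconst (mconst (mconst k)))
       (\<lambda>(i, m). if i \<in> {1..r} \<and> m = pure (d i) then mvar i - mconst (chart_tail i)
          else mconst (mconst (mvar (i, m)))))
     (\<lambda>v. mconst (mvar v))"

lemma mmm: "comm_ring_hom_ty (\<lambda>k. mconst (mconst (mconst k)))"
  by (rule comp_hom[OF mconst_hom mm])

lemma untwist_hom: "comm_ring_hom_ty untwist"
  unfolding untwist_def by (intro meval_hom mmm)

lemma untwist_gens:
  "untwist (mconst (mconst k)) = mconst (mconst (mconst k))"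
  "untwist (mconst (mvar (i, m))) = (if i \<in> {1..r} \<and> m = pure (d i)
     then mvar i - mconst (chart_tail i) else mconst (mconst (mvar (i, m))))"
  "untwist (mvar v) = mconst (mvar v)"
  unfolding untwist_def
  by (simp_all add: meval_mconst[OF meval_hom[OF mmm]] meval_mvar[OF meval_hom[OF mmm]]
      meval_mconst[OF mmm] meval_mvar[OF mmm])

lemma untwist_chart_tail: "untwist (chart_tail i) = mconst (chart_tail i)"
proof -
  have x: "untwist (chart_x v) = mconst (chart_x v)" for v
    by (cases v) (auto simp: chart_x_def untwist_gens homD[OF untwist_hom] homD[OF mconst_hom])
  show ?thesis
    unfolding chart_tail_def homD[OF untwist_hom] homD[OF mconst_hom] meval_mon_def
    by (intro sum.cong refl) (auto simp: x untwist_gens)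
qed

lemma untwist_chart_form: "i \<in> {1..r} \<Longrightarrow> untwist (chart_form i) = mvar i"
  by (simp add: chart_form_def homD[OF untwist_hom] untwist_gens untwist_chart_tail)

lemma untwist_chart_coef: "untwist (chart_coef a) = mconst (chart_coef a)"
proof (rule hom_eqI[OF comp_hom[OF untwist_hom chart_coef_hom] comp_hom[OF mconst_hom chart_coef_hom]])
  show "untwist (chart_coef (mconst k)) = mconst (chart_coef (mconst k))" for k
    by (simp add: chart_coef_mconst untwist_gens)
  show "untwist (chart_coef (mvar u)) = mconst (chart_coef (mvar u))" for u
    by (cases u) (auto simp: chart_coef_mvar untwist_gens untwist_chart_tail
        homD[OF untwist_hom] homD[OF mconst_hom])
qed

text \<open>Applying \<open>untwist\<close> turns the value into the polynomial with coefficients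
  \<open>chart_coef (lookup p m)\<close>, which is zero only if all of them are.\<close>

lemma meval_chart_form_eq_zero_iff:
  fixes p :: "(nat, 'k::idom coef) mpol"
  assumes p: "p \<in> poly_set {1..r} S"
  shows "meval chart_coef chart_form p = 0 \<longleftrightarrow> (\<forall>m\<in>Poly_Mapping.keys p. chart_coef (Poly_Mapping.lookup p m) = 0)"
proof
  assume "\<forall>m\<in>Poly_Mapping.keys p. chart_coef (Poly_Mapping.lookup p m) = 0"
  then show "meval chart_coef chart_form p = 0" by (simp add: meval_def)
next
  let ?q = "meval (\<lambda>a. mconst (chart_coef a)) mvar p :: (nat, (xvar, 'k coef) mpol) mpol"
  have vars: "i \<in> {1..r}" if "m \<in> Poly_Mapping.keys p" "i \<in> Poly_Mapping.keys m" for m i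
    using p that unfolding poly_set_def by blast
  assume "meval chart_coef chart_form p = 0"
  then have "untwist (meval chart_coef chart_form p) = 0" by (simp add: homD[OF untwist_hom])
  also have "untwist (meval chart_coef chart_form p) = ?q"
    unfolding hom_meval[OF untwist_hom] untwist_chart_coef unfolding meval_def
    by (intro sum.cong prod.cong arg_cong2[of _ _ _ _ "(*)"] arg_cong2[of _ _ _ _ "(^)"] refl untwist_chart_form vars)
  also have "?q = (\<Sum>m\<in>Poly_Mapping.keys p. Poly_Mapping.single m (chart_coef (Poly_Mapping.lookup p m)))"
    by (simp add: meval_def single_eq)
  finally have zero: "(\<Sum>m\<in>Poly_Mapping.keys p. Poly_Mapping.single m (chart_coef (Poly_Mapping.lookup p m))) = 0" .
  show "\<forall>m\<in>Poly_Mapping.keys p. chart_coef (Poly_Mapping.lookup p m) = 0"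
  proof
    fix m assume m: "m \<in> Poly_Mapping.keys p"
    have "Poly_Mapping.lookup (\<Sum>m\<in>Poly_Mapping.keys p. Poly_Mapping.single m (chart_coef (Poly_Mapping.lookup p m))) m
        = chart_coef (Poly_Mapping.lookup p m)"
      using m by (simp add: lookup_sum lookup_single when_def)
    then show "chart_coef (Poly_Mapping.lookup p m) = 0" using zero by simp
  qed
qed

end

theorem mainTheorem4:
  fixes r s :: nat and n :: "nat \<Rightarrow> nat" and d :: "nat \<Rightarrow> nat \<Rightarrow> nat"
    and F :: "(nat, 'k::idom coef) mpol \<Rightarrow> (xvar, 'k coef) mpol"
    and G :: "(nat, 'k coef) mpol \<Rightarrow> (nat, 'k coef) mpol"
  assumes "1 \<le> s"
    and "1 \<le> n 1"
    and "\<forall>j\<in>{1..<s}. n j \<le> n (j + 1)"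
    and "\<forall>i\<in>{1..r}. \<forall>j\<in>{1..s}. 1 \<le> d i j"
    and "F \<in> ring_hom (subring_of (AT_set r s n d)) (subring_of (Xt_set r s n d))"
    and "\<forall>a\<in>A_set r s n d. F (mconst a) = mconst a"
    and "\<forall>i\<in>{1..r}. F (mvar i) = gen_form_dehom s n d i"
    and "G \<in> ring_iso (subring_of (AT_set r s n d)) (subring_of (AT_set r s n d))"
    and "\<forall>p\<in>A'T_set r s n d. G p = p"
    and "\<forall>i\<in>{1..r}. G (mconst (mvar (eps_var s n d i))) = mconst (mvar (eps_var s n d i)) - mvar i"
  shows "a_kernel (subring_of (AT_set r s n d)) (subring_of (Xt_set r s n d)) F
    = G ` poly_set {1..r} (resultant_ideal r s n d)"
proof -
  define \<kappa> where "\<kappa> = (\<lambda>j. n j + 1)"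
  interpret top: chart r s n d \<kappa> by unfold_locales (auto simp: \<kappa>_def)
  let ?A = "A_set r s n d :: 'k coef set" and ?AT = "AT_set r s n d :: (nat, 'k coef) mpol set"
  let ?R = "subring_of ?AT"
  have eps: "eps_var s n d i = (i, top.pure (d i))" for i
    unfolding eps_var_def top.pure_def by (simp add: \<kappa>_def)
  have form: "gen_form_dehom s n d i = top.chart_form i" for i
    unfolding gen_form_dehom_def top.meval_gen_form[symmetric] top.chart_x_def by (simp add: \<kappa>_def)
  have res: "a \<in> resultant_ideal r s n d \<longleftrightarrow> a \<in> A_set r s n d \<and> top.chart_coef a = 0" for a :: "'k coef"
    unfolding \<kappa>_def by (rule resultant_ideal_eq)
  have G: "G \<in> ring_hom ?R ?R" and G_bij: "bij_betw G ?AT ?AT"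
    using assms(8) by (auto simp: ring_iso_def subring_of_def)
  have FG: "(\<lambda>p. F (G p)) \<in> ring_hom ?R (subring_of (Xt_set r s n d))"
    using ring_hom_trans[OF G assms(5)] by (simp add: comp_def)
  have AT: "is_subring ?AT" unfolding AT_set_def by (intro poly_set_subring A_subring)
  have F_diff: "F (x - y) = F x - F y" if "x \<in> ?AT" "y \<in> ?AT" for x y
    using ring_hom_add[OF assms(5), of "x - y" y] that subringD(6)[OF AT that]
    by (simp add: subring_of_def)
  have AT_var: "mvar i \<in> ?AT" if "i \<in> {1..r}" for i
    unfolding AT_set_def using that by (intro mvar_mem A_subring)
  have AT_const: "mconst a \<in> ?AT" if "a \<in> ?A" for a
    unfolding AT_set_def using that by (intro mconst_mem A_subring)
  have A'T: "is_subring (A'_set r s n d :: 'k coef set)"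
    unfolding A'_set_def by (intro poly_set_subring is_subring_UNIV)
  have FG_var: "F (G (mvar i)) = top.chart_form i" if "i \<in> {1..r}" for i
  proof -
    have "(mvar i :: (nat, 'k coef) mpol) \<in> A'T_set r s n d" unfolding A'T_set_def using that A'T by (intro mvar_mem)
    then show ?thesis using assms(7,9) that form by simp
  qed
  have FG_coef: "F (G (mconst a)) = top.chart_coef a" if a: "a \<in> ?A" for a
  proof -
    have "(\<lambda>a. F (G (mconst a))) \<in> ring_hom (subring_of (poly_set (U_vars r s n d) UNIV))
        (subring_of (Xt_set r s n d))"
    proof -
      have "mconst \<in> ring_hom (subring_of ?A) ?R" by (rule ring_homI[OF mconst_hom AT_const])
      from ring_hom_trans[OF this FG] show ?thesis by (simp add: comp_def A_set_def)
    qed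
    from hom_on_poly_set[OF is_subring_UNIV this a[unfolded A_set_def]]
    have "F (G (mconst a)) = meval (\<lambda>k. F (G (mconst (mconst k)))) (\<lambda>u. F (G (mconst (mvar u)))) a" .
    also have "\<dots> = meval (\<lambda>k. top.chart_coef (mconst k)) (\<lambda>u. top.chart_coef (mvar u)) a"
      unfolding meval_def
    proof (intro sum.cong prod.cong arg_cong2[of _ _ _ _ "(*)"] arg_cong2[of _ _ _ _ "(^)"] refl)
      have A': "F (G (mconst b)) = mconst b" if "b \<in> A'_set r s n d" for b
      proof -
        have "mconst b \<in> A'T_set r s n d" unfolding A'T_set_def by (rule mconst_mem[OF A'T that])
        moreover have "b \<in> ?A" using that by (auto simp: A'_set_def A_set_def poly_set_def)
        ultimately show ?thesis using assms(6,9) by simp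
      qed
      show "F (G (mconst (mconst k))) = top.chart_coef (mconst k)" for k
      proof -
        have "F (G (mconst (mconst k))) = mconst (mconst k)"
          by (rule A') (auto simp: A'_set_def mconst_mem[OF is_subring_UNIV])
        then show ?thesis unfolding top.chart_coef_mconst .
      qed
      fix m u assume "m \<in> Poly_Mapping.keys a" "u \<in> Poly_Mapping.keys m"
      then have u: "u \<in> U_vars r s n d" using a by (auto simp: A_set_def poly_set_def)
      show "F (G (mconst (mvar u))) = top.chart_coef (mvar u)"
      proof (cases "u \<in> eps_var s n d ` {1..r}")
        case True
        then obtain i where i: "i \<in> {1..r}" "u = eps_var s n d i" by blast
        have "mvar u \<in> ?A" unfolding A_set_def by (rule mvar_mem[OF is_subring_UNIV u])
        then have "F (mconst (mvar u) - mvar i) = mconst (mvar u) - top.chart_form i"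
          using F_diff[OF AT_const AT_var[OF i(1)]] assms(6,7) i(1) form by simp
        then show ?thesis
          using i assms(10) by (simp add: eps top.chart_coef_mvar top.chart_form_def)
      next
        case False
        then have "mvar u \<in> (A'_set r s n d :: 'k coef set)"
          unfolding A'_set_def using u by (intro mvar_mem is_subring_UNIV) auto
        moreover have "top.chart_coef (mvar u) = mconst (mvar u :: 'k coef)"
          using False by (cases u) (auto simp: top.chart_coef_mvar eps)
        ultimately show ?thesis using A' by simp
      qed
    qed
    also have "\<dots> = top.chart_coef a"
      unfolding hom_meval[OF top.chart_coef_hom, symmetric] meval_generators ..
    finally show ?thesis .
  qed
  have FG_eq: "F (G p) = meval top.chart_coef top.chart_form p" if p: "p \<in> ?AT" for p
  proof -
    have keys: "m \<in> Poly_Mapping.keys p \<Longrightarrow> i \<in> Poly_Mapping.keys m \<Longrightarrow> i \<in> {1..r}"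
        "m \<in> Poly_Mapping.keys p \<Longrightarrow> Poly_Mapping.lookup p m \<in> ?A" for m i
      using p unfolding AT_set_def poly_set_def by blast+
    have "F (G p) = meval (\<lambda>a. F (G (mconst a))) (\<lambda>v. F (G (mvar v))) p"
      by (rule hom_on_poly_set[OF A_subring FG[unfolded AT_set_def] p[unfolded AT_set_def]])
    also have "\<dots> = meval top.chart_coef top.chart_form p"
      unfolding meval_def
      by (intro sum.cong prod.cong arg_cong2[of _ _ _ _ "(*)"] arg_cong2[of _ _ _ _ "(^)"] refl FG_var FG_coef keys)
    finally show ?thesis .
  qed
  have ker: "F (G p) = 0 \<longleftrightarrow> p \<in> poly_set {1..r} (resultant_ideal r s n d)" if p: "p \<in> ?AT" for p
    using p top.meval_chart_form_eq_zero_iff[OF p[unfolded AT_set_def]]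
    by (auto simp: FG_eq AT_set_def poly_set_def res)
  have sub: "poly_set {1..r} (resultant_ideal r s n d) \<subseteq> ?AT"
    by (auto simp: AT_set_def poly_set_def res)
  have "a_kernel ?R (subring_of (Xt_set r s n d)) F = {q \<in> G ` ?AT. F q = 0}"
    using bij_betw_imp_surj_on[OF G_bij] by (simp add: a_kernel_def' subring_of_def)
  also have "\<dots> = G ` poly_set {1..r} (resultant_ideal r s n d)" using ker sub by blast
  finally show ?thesis .
qed

end
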